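(* Let $M=X^{*}G$ be a symmetric Rees monoid. Then the group of fractions $U(M)$ of $M$ is isomorphic to a Zappa-Szép product of the free group on $X$ and $G$, that is, $$U(M)\cong FG(X)\bowtie G.$$
   Context: A monoid $M$ is a left Rees monoid if it is left cancellative, right rigid ($aM\cap bM\neq\emptyset$ implies $aM\subseteq bM$ or $bM\subseteq aM$), each principal right ideal is properly contained in only finitely many principal right ideals, and $M$ is not a group. Right Rees monoids are defined dually; a Rees monoid is one that is both left and right Rees. If $G$ is the group of units of a left Rees monoid $M$ and $X$ is a transversal of the generators of the maximal proper principal right ideals, then the submonoid $X^*$ generated by $X$ is free on $X$ and every element of $M$ is uniquely a product $xg$ with $x\in X^*$, $g\in G$; one writes $M=X^*G$. For $g\in G$, $x\in X^*$ write $gx=(g\cdot x)(g|_x)$ with $g\cdot x\in X^*$, $g|_x\in G$. $M$ is symmetric if for every $x\in X$ the map $\rho_x:G\to G$, $g\mapsto g|_x$, is a bijection. The group of fractions $U(M)$ is the universal group receiving a homomorphism from $M$. $FG(X)$ is the free group on $X$. The Zappa-Szép product $FG(X)\bowtie G$ is the group on the set $FG(X)\times G$ with product $(x,g)(y,h)=(x(g\cdot y),g|_yh)$, for maps $G\times FG(X)\to FG(X)$, $(g,x)\mapsto g\cdot x$ and $G\times FG(X)\to G$, $(g,x)\mapsto g|_x$ which satisfy, for all $g,h\in G$, $x,y\in FG(X)$: $1\cdot x=x$; $(gh)\cdot x=g\cdot(h\cdot x)$; $g\cdot1=1$; $g\cdot(xy)=(g\cdot x)(g|_x\cdot y)$;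 $g|_1=g$; $g|_{xy}=(g|_x)|_y$; $1|_x=1$; $(gh)|_x=g|_{h\cdot x}h|_x$. Here these maps extend the given ones on $X^*$ (such an extension exists because $M$ is symmetric; it is determined by $g|_{x^{-1}}=\rho_x^{-1}(g)$ and $g\cdot x^{-1}=(g|_{x^{-1}}\cdot x)^{-1}$ for $x\in X$). *)

theory Defs
  imports "HOL-Algebra.Coset"
begin

section \<open>Rees monoids\<close>

text \<open>The principal right ideal \<open>aM\<close> is \<open>a <#\<^bsub>M\<^esub> carrier M\<close> and the principal left ideal
  \<open>Ma\<close> is \<open>carrier M #>\<^bsub>M\<^esub> a\<close>.\<close>

definition left_rees_monoid :: "('a, 'b) monoid_scheme \<Rightarrow> bool" where
  "left_rees_monoid M \<longleftrightarrow>
     monoid M \<and>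
     (\<forall>a\<in>carrier M. \<forall>b\<in>carrier M. \<forall>c\<in>carrier M. a \<otimes>\<^bsub>M\<^esub> b = a \<otimes>\<^bsub>M\<^esub> c \<longrightarrow> b = c) \<and>
     (\<forall>a\<in>carrier M. \<forall>b\<in>carrier M.
        (a <#\<^bsub>M\<^esub> carrier M) \<inter> (b <#\<^bsub>M\<^esub> carrier M) \<noteq> {} \<longrightarrow>
        a <#\<^bsub>M\<^esub> carrier M \<subseteq> b <#\<^bsub>M\<^esub> carrier M \<or> b <#\<^bsub>M\<^esub> carrier M \<subseteq> a <#\<^bsub>M\<^esub> carrier M) \<and>
     (\<forall>a\<in>carrier M. finite {I. \<exists>b\<in>carrier M. I = b <#\<^bsub>M\<^esub> carrier M \<and> a <#\<^bsub>M\<^esub> carrier M \<subset> I}) \<and>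
     \<not> group M"

definition right_rees_monoid :: "('a, 'b) monoid_scheme \<Rightarrow> bool" where
  "right_rees_monoid M \<longleftrightarrow>
     monoid M \<and>
     (\<forall>a\<in>carrier M. \<forall>b\<in>carrier M. \<forall>c\<in>carrier M. b \<otimes>\<^bsub>M\<^esub> a = c \<otimes>\<^bsub>M\<^esub> a \<longrightarrow> b = c) \<and>
     (\<forall>a\<in>carrier M. \<forall>b\<in>carrier M.
        (carrier M #>\<^bsub>M\<^esub> a) \<inter> (carrier M #>\<^bsub>M\<^esub> b) \<noteq> {} \<longrightarrow>
        carrier M #>\<^bsub>M\<^esub> a \<subseteq> carrier M #>\<^bsub>M\<^esub> b \<or> carrier M #>\<^bsub>M\<^esub> b \<subseteq> carrier M #>\<^bsub>M\<^esub> a) \<and>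
     (\<forall>a\<in>carrier M. finite {I. \<exists>b\<in>carrier M. I = carrier M #>\<^bsub>M\<^esub> b \<and> carrier M #>\<^bsub>M\<^esub> a \<subset> I}) \<and>
     \<not> group M"

definition rees_monoid :: "('a, 'b) monoid_scheme \<Rightarrow> bool" where
  "rees_monoid M \<longleftrightarrow> left_rees_monoid M \<and> right_rees_monoid M"

definition maximal_generator :: "('a, 'b) monoid_scheme \<Rightarrow> 'a \<Rightarrow> bool" where
  "maximal_generator M a \<longleftrightarrow>
     a \<in> carrier M \<and> a <#\<^bsub>M\<^esub> carrier M \<noteq> carrier M \<and>
     (\<forall>b\<in>carrier M. a <#\<^bsub>M\<^esub> carrier M \<subset> b <#\<^bsub>M\<^esub> carrier M \<longrightarrow> b <#\<^bsub>M\<^esub> carrier M = carrier M)"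

definition is_transversal :: "('a, 'b) monoid_scheme \<Rightarrow> 'a set \<Rightarrow> bool" where
  "is_transversal M X \<longleftrightarrow>
     (\<forall>x\<in>X. maximal_generator M x) \<and>
     (\<forall>a. maximal_generator M a \<longrightarrow> (\<exists>!x. x \<in> X \<and> x <#\<^bsub>M\<^esub> carrier M = a <#\<^bsub>M\<^esub> carrier M))"

definition star :: "('a, 'b) monoid_scheme \<Rightarrow> 'a set \<Rightarrow> 'a set" where
  "star M X = \<Inter>{N. submonoid N M \<and> X \<subseteq> N}"

text \<open>\<open>dot M X g x\<close> and \<open>restr M X g x\<close> are the two factors \<open>g \<cdot> x\<close> and \<open>g|\<^sub>x\<close> of
  \<open>g \<otimes> x\<close>. The descriptions are well defined whenever \<open>M\<close> is a left Rees monoid and \<open>X\<close> a transversal,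
  since then the factorization into an element of \<open>star M X\<close> and a unit exists and is unique.\<close>

definition dot :: "('a, 'b) monoid_scheme \<Rightarrow> 'a set \<Rightarrow> 'a \<Rightarrow> 'a \<Rightarrow> 'a" where
  "dot M X g x = (THE y. y \<in> star M X \<and> (\<exists>h\<in>Units M. g \<otimes>\<^bsub>M\<^esub> x = y \<otimes>\<^bsub>M\<^esub> h))"

definition restr :: "('a, 'b) monoid_scheme \<Rightarrow> 'a set \<Rightarrow> 'a \<Rightarrow> 'a \<Rightarrow> 'a" where
  "restr M X g x = (THE h. h \<in> Units M \<and> (\<exists>y\<in>star M X. g \<otimes>\<^bsub>M\<^esub> x = y \<otimes>\<^bsub>M\<^esub> h))"

definition symmetric_monoid :: "('a, 'b) monoid_scheme \<Rightarrow> 'a set \<Rightarrow> bool" where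
  "symmetric_monoid M X \<longleftrightarrow> (\<forall>x\<in>X. bij_betw (\<lambda>g. restr M X g x) (Units M) (Units M))"


section \<open>Groups given by generators and relations\<close>

text \<open>A letter \<open>(x, True)\<close> stands for the generator \<open>x\<close> and \<open>(x, False)\<close> for its inverse.\<close>

type_synonym 'a gword = "('a \<times> bool) list"

abbreviation gwords :: "'a set \<Rightarrow> 'a gword set" where
  "gwords X \<equiv> lists (X \<times> UNIV)"

inductive_set pres_rel :: "'a set \<Rightarrow> ('a gword \<times> 'a gword) set \<Rightarrow> ('a gword \<times> 'a gword) set"
  for X :: "'a set" and R :: "('a gword \<times> 'a gword) set" where
  refl: "w \<in> gwords X \<Longrightarrow> (w, w) \<in> pres_rel X R"
| sym: "(u, v) \<in> pres_rel X R \<Longrightarrow> (v, u) \<in> pres_rel X R"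
| trans: "(u, v) \<in> pres_rel X R \<Longrightarrow> (v, w) \<in> pres_rel X R \<Longrightarrow> (u, w) \<in> pres_rel X R"
| cancel: "u \<in> gwords X \<Longrightarrow> v \<in> gwords X \<Longrightarrow> x \<in> X \<Longrightarrow>
    (u @ [(x, b), (x, \<not> b)] @ v, u @ v) \<in> pres_rel X R"
| rel: "u \<in> gwords X \<Longrightarrow> v \<in> gwords X \<Longrightarrow> (r, s) \<in> R \<Longrightarrow> r \<in> gwords X \<Longrightarrow> s \<in> gwords X \<Longrightarrow>
    (u @ r @ v, u @ s @ v) \<in> pres_rel X R"

definition presented_group :: "'a set \<Rightarrow> ('a gword \<times> 'a gword) set \<Rightarrow> 'a gword set monoid" where
  "presented_group X R =
     \<lparr>carrier = gwords X // pres_rel X R,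
      mult = (\<lambda>A B. \<Union>u\<in>A. \<Union>v\<in>B. pres_rel X R `` {u @ v}),
      one = pres_rel X R `` {[]}\<rparr>"

definition free_grp :: "'a set \<Rightarrow> 'a gword set monoid" where
  "free_grp X = presented_group X {}"

text \<open>\<open>M\<close> need not embed in the group; the canonical map is \<open>fractions_map M\<close>, and its
  universal property is \<open>fractions_group_universal\<close> below.\<close>

definition mult_rel :: "('a, 'b) monoid_scheme \<Rightarrow> ('a gword \<times> 'a gword) set" where
  "mult_rel M = {([(a, True), (b, True)], [(a \<otimes>\<^bsub>M\<^esub> b, True)]) | a b. a \<in> carrier M \<and> b \<in> carrier M}"

definition fractions_group :: "('a, 'b) monoid_scheme \<Rightarrow> 'a gword set monoid" where
  "fractions_group M = presented_group (carrier M) (mult_rel M)"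

definition fractions_map :: "('a, 'b) monoid_scheme \<Rightarrow> 'a \<Rightarrow> 'a gword set" where
  "fractions_map M a = pres_rel (carrier M) (mult_rel M) `` {[(a, True)]}"

text \<open>The canonical homomorphism from the free monoid \<open>star M X\<close> to the free group.\<close>

definition star_to_free :: "('a, 'b) monoid_scheme \<Rightarrow> 'a set \<Rightarrow> 'a \<Rightarrow> 'a gword set" where
  "star_to_free M X y =
     (THE c. \<exists>xs\<in>lists X. y = foldr (\<otimes>\<^bsub>M\<^esub>) xs \<one>\<^bsub>M\<^esub> \<and>
                           c = pres_rel X {} `` {map (\<lambda>x. (x, True)) xs})"


section \<open>Zappa-Szep products\<close>

locale zappa_szep = F: group F + G: group G
  for F :: "('f, 'm) monoid_scheme" and G :: "('g, 'n) monoid_scheme" +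
  fixes act :: "'g \<Rightarrow> 'f \<Rightarrow> 'f" and res :: "'g \<Rightarrow> 'f \<Rightarrow> 'g"
  assumes act_closed: "\<lbrakk>g \<in> carrier G; x \<in> carrier F\<rbrakk> \<Longrightarrow> act g x \<in> carrier F"
    and res_closed: "\<lbrakk>g \<in> carrier G; x \<in> carrier F\<rbrakk> \<Longrightarrow> res g x \<in> carrier G"
    and one_act: "x \<in> carrier F \<Longrightarrow> act \<one>\<^bsub>G\<^esub> x = x"
    and mult_act: "\<lbrakk>g \<in> carrier G; h \<in> carrier G; x \<in> carrier F\<rbrakk> \<Longrightarrow>
          act (g \<otimes>\<^bsub>G\<^esub> h) x = act g (act h x)"
    and act_one: "g \<in> carrier G \<Longrightarrow> act g \<one>\<^bsub>F\<^esub> = \<one>\<^bsub>F\<^esub>"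
    and act_mult: "\<lbrakk>g \<in> carrier G; x \<in> carrier F; y \<in> carrier F\<rbrakk> \<Longrightarrow>
          act g (x \<otimes>\<^bsub>F\<^esub> y) = act g x \<otimes>\<^bsub>F\<^esub> act (res g x) y"
    and res_one: "g \<in> carrier G \<Longrightarrow> res g \<one>\<^bsub>F\<^esub> = g"
    and res_mult: "\<lbrakk>g \<in> carrier G; x \<in> carrier F; y \<in> carrier F\<rbrakk> \<Longrightarrow>
          res g (x \<otimes>\<^bsub>F\<^esub> y) = res (res g x) y"
    and one_res: "x \<in> carrier F \<Longrightarrow> res \<one>\<^bsub>G\<^esub> x = \<one>\<^bsub>G\<^esub>"
    and mult_res: "\<lbrakk>g \<in> carrier G; h \<in> carrier G; x \<in> carrier F\<rbrakk> \<Longrightarrow>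
          res (g \<otimes>\<^bsub>G\<^esub> h) x = res g (act h x) \<otimes>\<^bsub>G\<^esub> res h x"

definition zappa_szep_product ::
  "('f, 'm) monoid_scheme \<Rightarrow> ('g, 'n) monoid_scheme \<Rightarrow> ('g \<Rightarrow> 'f \<Rightarrow> 'f) \<Rightarrow> ('g \<Rightarrow> 'f \<Rightarrow> 'g) \<Rightarrow> ('f \<times> 'g) monoid"
  where
  "zappa_szep_product F G act res =
     \<lparr>carrier = carrier F \<times> carrier G,
      mult = (\<lambda>(x, g) (y, h). (x \<otimes>\<^bsub>F\<^esub> act g y, res g y \<otimes>\<^bsub>G\<^esub> h)),
      one = (\<one>\<^bsub>F\<^esub>, \<one>\<^bsub>G\<^esub>)\<rparr>"

definition extends_star_maps ::
  "('a, 'b) monoid_scheme \<Rightarrow> 'a set \<Rightarrow> ('a \<Rightarrow> 'a gword set \<Rightarrow> 'a gword set) \<Rightarrow> ('a \<Rightarrow> 'a gword set \<Rightarrow> 'a) \<Rightarrow> bool"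
  where
  "extends_star_maps M X act res \<longleftrightarrow>
     zappa_szep (free_grp X) (units_of M) act res \<and>
     (\<forall>g\<in>Units M. \<forall>x\<in>star M X.
        act g (star_to_free M X x) = star_to_free M X (dot M X g x) \<and>
        res g (star_to_free M X x) = restr M X g x)"


section \<open>Basic properties of the constructions\<close>

lemma pres_rel_subset: "(u, v) \<in> pres_rel X R \<Longrightarrow> u \<in> gwords X \<and> v \<in> gwords X"
  by (induction rule: pres_rel.induct) auto

lemma equiv_pres_rel: "equiv (gwords X) (pres_rel X R)"
proof (rule equivI)
  show "pres_rel X R \<subseteq> gwords X \<times> gwords X"
    using pres_rel_subset by fast
  show "refl_on (gwords X) (pres_rel X R)"
    by (simp add: refl_on_def pres_rel.refl)
  show "Relation.sym (pres_rel X R)" by (rule symI) (rule pres_rel.sym)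
  show "Relation.trans (pres_rel X R)" by (rule transI) (rule pres_rel.trans)
qed

lemma pres_rel_context:
  assumes "(u, v) \<in> pres_rel X R" "p \<in> gwords X" "q \<in> gwords X"
  shows "(p @ u @ q, p @ v @ q) \<in> pres_rel X R"
  using assms
proof (induction rule: pres_rel.induct)
  case (refl w)
  have "p @ w @ q \<in> gwords X" using refl by simp
  thus ?case by (rule pres_rel.refl)
next
  case (sym u v) thus ?case by (blast intro: pres_rel.sym)
next
  case (trans u v w) thus ?case by (blast intro: pres_rel.trans)
next
  case (cancel u v x b)
  have "p @ u \<in> gwords X" "v @ q \<in> gwords X" using cancel by auto
  from pres_rel.cancel[OF this cancel(3), of b R] show ?case by simp
next
  case (rel u v r s)
  have "p @ u \<in> gwords X" "v @ q \<in> gwords X" using rel by auto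
  from pres_rel.rel[OF this rel(3-5)] show ?case by simp
qed

lemma pres_rel_append:
  assumes "(u, u') \<in> pres_rel X R" "(v, v') \<in> pres_rel X R"
  shows "(u @ v, u' @ v') \<in> pres_rel X R"
proof -
  have "(u @ v, u' @ v) \<in> pres_rel X R"
    using pres_rel_context[OF assms(1), of "[]" v] pres_rel_subset[OF assms(2)] by simp
  moreover have "(u' @ v, u' @ v') \<in> pres_rel X R"
    using pres_rel_context[OF assms(2), of u' "[]"] pres_rel_subset[OF assms(1)] by simp
  ultimately show ?thesis by (rule pres_rel.trans)
qed

lemma presented_group_mult:
  assumes "u \<in> gwords X" "v \<in> gwords X"
  shows "pres_rel X R `` {u} \<otimes>\<^bsub>presented_group X R\<^esub> pres_rel X R `` {v} = pres_rel X R `` {u @ v}"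
proof -
  have *: "pres_rel X R `` {u' @ v'} = pres_rel X R `` {u @ v}"
    if "(u, u') \<in> pres_rel X R" "(v, v') \<in> pres_rel X R" for u' v'
    using equiv_class_eq[OF equiv_pres_rel pres_rel_append[OF that]] by simp
  have "u \<in> pres_rel X R `` {u}" "v \<in> pres_rel X R `` {v}"
    using assms by (auto intro: pres_rel.refl)
  hence ne: "pres_rel X R `` {u} \<noteq> {}" "pres_rel X R `` {v} \<noteq> {}" by blast+
  have "pres_rel X R `` {u} \<otimes>\<^bsub>presented_group X R\<^esub> pres_rel X R `` {v} =
          (\<Union>u'\<in>pres_rel X R `` {u}. \<Union>v'\<in>pres_rel X R `` {v}. pres_rel X R `` {u' @ v'})"
    by (simp add: presented_group_def)
  also have "\<dots> = (\<Union>u'\<in>pres_rel X R `` {u}. \<Union>v'\<in>pres_rel X R `` {v}. pres_rel X R `` {u @ v})"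
    using * by (intro SUP_cong HOL.refl) (simp only: Image_singleton_iff)
  also have "\<dots> = pres_rel X R `` {u @ v}"
    by (simp only: UN_constant ne if_False)
  finally show ?thesis .
qed

lemma presented_group_cases:
  assumes "A \<in> carrier (presented_group X R)"
  obtains w where "w \<in> gwords X" "A = pres_rel X R `` {w}"
proof -
  from assms have "A \<in> gwords X // pres_rel X R" by (simp add: presented_group_def)
  thus ?thesis by (rule quotientE) (rule that)
qed

lemma presented_group_class: "w \<in> gwords X \<Longrightarrow> pres_rel X R `` {w} \<in> carrier (presented_group X R)"
  unfolding presented_group_def by (auto intro: quotientI)

lemma presented_group_one: "\<one>\<^bsub>presented_group X R\<^esub> = pres_rel X R `` {[]}"
  by (simp add: presented_group_def)

lemma pres_rel_inverse:
  "w \<in> gwords X \<Longrightarrow> (rev (map (\<lambda>(x, b). (x, \<not> b)) w) @ w, []) \<in> pres_rel X R"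
proof (induction w)
  case Nil thus ?case by (simp add: pres_rel.refl)
next
  case (Cons a w)
  obtain x b where a: "a = (x, b)" by (cases a)
  define i where "i = rev (map (\<lambda>(x, b). (x, \<not> b)) w)"
  have i: "i \<in> gwords X" using Cons.prems by (auto simp: i_def)
  have "(i @ [(x, \<not> b), (x, \<not> \<not> b)] @ w, i @ w) \<in> pres_rel X R"
    using Cons.prems a i by (intro pres_rel.cancel) auto
  moreover have "(i @ w, []) \<in> pres_rel X R" using Cons by (simp add: i_def)
  ultimately show ?case by (simp add: a i_def) (rule pres_rel.trans)
qed

lemma group_presented_group: "group (presented_group X R)"
proof (rule groupI)
  let ?P = "presented_group X R"
  show "\<one>\<^bsub>?P\<^esub> \<in> carrier ?P" by (simp add: presented_group_one presented_group_class)
  show "A \<otimes>\<^bsub>?P\<^esub> B \<in> carrier ?P" if A: "A \<in> carrier ?P" and B: "B \<in> carrier ?P" for A B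
  proof -
    obtain u where u: "u \<in> gwords X" "A = pres_rel X R `` {u}" using A by (rule presented_group_cases)
    obtain v where v: "v \<in> gwords X" "B = pres_rel X R `` {v}" using B by (rule presented_group_cases)
    have "u @ v \<in> gwords X" using u v by simp
    thus ?thesis unfolding u(2) v(2) presented_group_mult[OF u(1) v(1)]
      by (rule presented_group_class)
  qed
  show "A \<otimes>\<^bsub>?P\<^esub> B \<otimes>\<^bsub>?P\<^esub> C = A \<otimes>\<^bsub>?P\<^esub> (B \<otimes>\<^bsub>?P\<^esub> C)"
    if A: "A \<in> carrier ?P" and B: "B \<in> carrier ?P" and C: "C \<in> carrier ?P" for A B C
  proof -
    obtain u where u: "u \<in> gwords X" "A = pres_rel X R `` {u}" using A by (rule presented_group_cases)
    obtain v where v: "v \<in> gwords X" "B = pres_rel X R `` {v}" using B by (rule presented_group_cases)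
    obtain w where w: "w \<in> gwords X" "C = pres_rel X R `` {w}" using C by (rule presented_group_cases)
    have "u @ v \<in> gwords X" "v @ w \<in> gwords X" using u v w by simp_all
    thus ?thesis using u v w by (simp add: presented_group_mult)
  qed
  show "\<one>\<^bsub>?P\<^esub> \<otimes>\<^bsub>?P\<^esub> A = A" if A: "A \<in> carrier ?P" for A
  proof -
    obtain u where u: "u \<in> gwords X" "A = pres_rel X R `` {u}" using A by (rule presented_group_cases)
    show ?thesis using u by (simp add: presented_group_mult presented_group_one)
  qed
  show "\<exists>B\<in>carrier ?P. B \<otimes>\<^bsub>?P\<^esub> A = \<one>\<^bsub>?P\<^esub>" if A: "A \<in> carrier ?P" for A
  proof -
    obtain u where u: "u \<in> gwords X" "A = pres_rel X R `` {u}" using A by (rule presented_group_cases)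
    define i where "i = rev (map (\<lambda>(x, b). (x, \<not> b)) u)"
    have i: "i \<in> gwords X" using u by (auto simp: i_def)
    have "(i @ u, []) \<in> pres_rel X R" unfolding i_def using u by (intro pres_rel_inverse)
    hence "pres_rel X R `` {i} \<otimes>\<^bsub>?P\<^esub> A = \<one>\<^bsub>?P\<^esub>"
      using u i by (simp add: presented_group_mult presented_group_one equiv_class_eq[OF equiv_pres_rel])
    thus ?thesis using presented_group_class[OF i] by blast
  qed
qed

definition gword_eval :: "('c, 'd) monoid_scheme \<Rightarrow> ('a \<Rightarrow> 'c) \<Rightarrow> 'a gword \<Rightarrow> 'c" where
  "gword_eval H f w =
     foldr (\<lambda>(x, b) y. (if b then f x else inv\<^bsub>H\<^esub> (f x)) \<otimes>\<^bsub>H\<^esub> y) w \<one>\<^bsub>H\<^esub>"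

context
  fixes H :: "('c, 'd) monoid_scheme" and f :: "'a \<Rightarrow> 'c" and X :: "'a set"
  assumes H: "group H" and f: "f \<in> X \<rightarrow> carrier H"
begin

interpretation H: group H by (rule H)

lemma gword_eval_closed: "w \<in> gwords X \<Longrightarrow> gword_eval H f w \<in> carrier H"
proof (induction w)
  case Nil
  thus ?case by (simp add: gword_eval_def)
next
  case (Cons a w)
  obtain x b where a: "a = (x, b)" by (cases a)
  have x: "f x \<in> carrier H" and w: "w \<in> gwords X" using f Cons.prems a by auto
  have "gword_eval H f (a # w) = (if b then f x else inv\<^bsub>H\<^esub> (f x)) \<otimes>\<^bsub>H\<^esub> gword_eval H f w"
    by (simp add: a gword_eval_def)
  thus ?case using x Cons.IH[OF w] by simp
qed

lemma gword_eval_append: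
  "u \<in> gwords X \<Longrightarrow> v \<in> gwords X \<Longrightarrow> gword_eval H f (u @ v) = gword_eval H f u \<otimes>\<^bsub>H\<^esub> gword_eval H f v"
proof (induction u)
  case Nil
  thus ?case using gword_eval_closed[of v] by (simp add: gword_eval_def)
next
  case (Cons a u)
  obtain x b where a: "a = (x, b)" by (cases a)
  have x: "f x \<in> carrier H" using f Cons.prems a by auto
  have "gword_eval H f (a # w) = (if b then f x else inv\<^bsub>H\<^esub> (f x)) \<otimes>\<^bsub>H\<^esub> gword_eval H f w" for w
    by (simp add: a gword_eval_def)
  thus ?case using Cons x gword_eval_closed[of u] gword_eval_closed[of v]
    by (simp add: H.m_assoc)
qed

lemma gword_eval_pres_rel:
  assumes R: "\<And>r s. (r, s) \<in> R \<Longrightarrow> gword_eval H f r = gword_eval H f s"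
    and "(u, v) \<in> pres_rel X R"
  shows "gword_eval H f u = gword_eval H f v"
  using assms(2)
proof (induction rule: pres_rel.induct)
  case (cancel u v x b)
  have x: "f x \<in> carrier H" using f cancel by auto
  have w: "[(x, b), (x, \<not> b)] \<in> gwords X" using cancel by auto
  hence wv: "[(x, b), (x, \<not> b)] @ v \<in> gwords X" using cancel by simp
  have "gword_eval H f [(x, b), (x, \<not> b)] = \<one>\<^bsub>H\<^esub>"
    using x by (simp add: gword_eval_def)
  thus ?case
    unfolding gword_eval_append[OF cancel(1) wv] gword_eval_append[OF w cancel(2)]
      gword_eval_append[OF cancel(1,2)]
    using gword_eval_closed[OF cancel(2)] by simp
next
  case (rel u v r s)
  have "r @ v \<in> gwords X" "s @ v \<in> gwords X" using rel by auto
  thus ?case using rel R[OF rel(3)] by (simp only: gword_eval_append)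
qed auto

lemma presented_group_universal:
  assumes R: "\<And>r s. (r, s) \<in> R \<Longrightarrow> gword_eval H f r = gword_eval H f s"
  shows "\<exists>\<phi>\<in>hom (presented_group X R) H. \<forall>x\<in>X. \<phi> (pres_rel X R `` {[(x, True)]}) = f x"
proof
  define \<phi> where "\<phi> A = (THE c. \<forall>w\<in>A. gword_eval H f w = c)" for A
  have \<phi>: "\<phi> (pres_rel X R `` {w}) = gword_eval H f w" if w: "w \<in> gwords X" for w
    unfolding \<phi>_def
  proof (rule the_equality)
    show "\<forall>v\<in>pres_rel X R `` {w}. gword_eval H f v = gword_eval H f w"
      using gword_eval_pres_rel[OF R] by fastforce
    show "c = gword_eval H f w" if "\<forall>v\<in>pres_rel X R `` {w}. gword_eval H f v = c" for c
      using that w by (auto intro: pres_rel.refl)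
  qed
  show "\<phi> \<in> hom (presented_group X R) H"
  proof (rule homI)
    fix A assume "A \<in> carrier (presented_group X R)"
    then obtain u where u: "u \<in> gwords X" "A = pres_rel X R `` {u}" by (rule presented_group_cases)
    thus "\<phi> A \<in> carrier H" using \<phi> gword_eval_closed by simp
    fix B assume "B \<in> carrier (presented_group X R)"
    then obtain v where v: "v \<in> gwords X" "B = pres_rel X R `` {v}" by (rule presented_group_cases)
    have "u @ v \<in> gwords X" using u v by simp
    from \<phi>[OF this] show "\<phi> (A \<otimes>\<^bsub>presented_group X R\<^esub> B) = \<phi> A \<otimes>\<^bsub>H\<^esub> \<phi> B"
      unfolding u(2) v(2) presented_group_mult[OF u(1) v(1)] \<phi>[OF u(1)] \<phi>[OF v(1)]
        gword_eval_append[OF u(1) v(1)] .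
  qed
  show "\<forall>x\<in>X. \<phi> (pres_rel X R `` {[(x, True)]}) = f x"
  proof
    fix x assume x: "x \<in> X"
    have "[(x, True)] \<in> gwords X" "f x \<in> carrier H" using x f by auto
    thus "\<phi> (pres_rel X R `` {[(x, True)]}) = f x" using \<phi> by (simp add: gword_eval_def)
  qed
qed

end

lemma presented_group_hom_unique:
  assumes H: "group H"
    and \<phi>: "\<phi> \<in> hom (presented_group X R) H" and \<psi>: "\<psi> \<in> hom (presented_group X R) H"
    and eq: "\<And>x. x \<in> X \<Longrightarrow> \<phi> (pres_rel X R `` {[(x, True)]}) = \<psi> (pres_rel X R `` {[(x, True)]})"
    and A: "A \<in> carrier (presented_group X R)"
  shows "\<phi> A = \<psi> A"
proof -
  let ?P = "presented_group X R"
  let ?c = "\<lambda>w. pres_rel X R `` {w}"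
  interpret P: group ?P by (rule group_presented_group)
  interpret p: group_hom ?P H \<phi>
    using H \<phi> P.group_axioms by (simp add: group_hom_def group_hom_axioms_def)
  interpret q: group_hom ?P H \<psi>
    using H \<psi> P.group_axioms by (simp add: group_hom_def group_hom_axioms_def)
  have letter: "\<phi> (?c [(x, b)]) = \<psi> (?c [(x, b)])" if x: "x \<in> X" for x b
  proof (cases b)
    case True thus ?thesis using eq[OF x] by simp
  next
    case False
    have t: "[(x, True)] \<in> gwords X" and n: "[(x, False)] \<in> gwords X" using x by auto
    have "([(x, False), (x, True)], []) \<in> pres_rel X R"
      using pres_rel.cancel[of "[]" X "[]" x False R] x by simp
    hence "?c [(x, False)] \<otimes>\<^bsub>?P\<^esub> ?c [(x, True)] = \<one>\<^bsub>?P\<^esub>"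
      unfolding presented_group_mult[OF n t] presented_group_one
      by (simp add: equiv_class_eq[OF equiv_pres_rel])
    hence "?c [(x, False)] = inv\<^bsub>?P\<^esub> (?c [(x, True)])"
      using P.inv_equality[OF _ presented_group_class[OF t] presented_group_class[OF n]] by simp
    thus ?thesis using False eq[OF x] presented_group_class[OF t] by simp
  qed
  have "\<phi> (?c w) = \<psi> (?c w)" if "w \<in> gwords X" for w
    using that
  proof (induction w rule: list.induct)
    case Nil
    have "\<phi> \<one>\<^bsub>?P\<^esub> = \<psi> \<one>\<^bsub>?P\<^esub>" by simp
    thus ?case by (simp only: presented_group_one)
  next
    case (Cons a w)
    obtain x b where a: "a = (x, b)" by (cases a)
    have l: "[(x, b)] \<in> gwords X" and w: "w \<in> gwords X" and x: "x \<in> X"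
      using Cons.prems[unfolded a] by simp_all
    have e: "?c (a # w) = ?c [(x, b)] \<otimes>\<^bsub>?P\<^esub> ?c w"
      unfolding presented_group_mult[OF l w] by (simp add: a)
    show ?case unfolding e
      using letter[OF x] Cons.IH[OF w] presented_group_class[OF l] presented_group_class[OF w] by simp
  qed
  thus ?thesis using A by (metis presented_group_cases)
qed

lemma group_free_grp: "group (free_grp X)"
  unfolding free_grp_def by (rule group_presented_group)

lemma free_grp_universal:
  assumes "group H" "f \<in> X \<rightarrow> carrier H"
  shows "\<exists>\<phi>\<in>hom (free_grp X) H. \<forall>x\<in>X. \<phi> (pres_rel X {} `` {[(x, True)]}) = f x"
  unfolding free_grp_def by (rule presented_group_universal[OF assms]) simp

lemma group_fractions_group: "group (fractions_group M)"
  unfolding fractions_group_def by (rule group_presented_group)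

lemma fractions_map_hom:
  assumes "monoid M"
  shows "fractions_map M \<in> hom M (fractions_group M)"
proof (rule homI)
  interpret monoid M by (rule assms)
  fix a assume a: "a \<in> carrier M"
  thus "fractions_map M a \<in> carrier (fractions_group M)"
    unfolding fractions_map_def fractions_group_def by (intro presented_group_class) auto
  fix b assume b: "b \<in> carrier M"
  have "([] @ [(a, True), (b, True)] @ [], [] @ [(a \<otimes>\<^bsub>M\<^esub> b, True)] @ [])
          \<in> pres_rel (carrier M) (mult_rel M)"
    using a b by (intro pres_rel.rel) (auto simp: mult_rel_def)
  hence e: "pres_rel (carrier M) (mult_rel M) `` {[(a, True)] @ [(b, True)]} = fractions_map M (a \<otimes>\<^bsub>M\<^esub> b)"
    unfolding fractions_map_def by (simp add: equiv_class_eq[OF equiv_pres_rel])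
  have "[(a, True)] \<in> gwords (carrier M)" "[(b, True)] \<in> gwords (carrier M)" using a b by auto
  from presented_group_mult[OF this, of "mult_rel M"] e
  show "fractions_map M (a \<otimes>\<^bsub>M\<^esub> b) = fractions_map M a \<otimes>\<^bsub>fractions_group M\<^esub> fractions_map M b"
    unfolding fractions_map_def fractions_group_def by simp
qed

lemma fractions_group_universal:
  assumes "monoid M" "group H" "f \<in> hom M H"
  shows "\<exists>\<phi>\<in>hom (fractions_group M) H. (\<forall>a\<in>carrier M. \<phi> (fractions_map M a) = f a) \<and>
           (\<forall>\<psi>\<in>hom (fractions_group M) H. (\<forall>a\<in>carrier M. \<psi> (fractions_map M a) = f a) \<longrightarrow>
              (\<forall>A\<in>carrier (fractions_group M). \<psi> A = \<phi> A))"
proof -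
  interpret M: monoid M by (rule assms)
  interpret H: group H by (rule assms)
  have f: "f \<in> carrier M \<rightarrow> carrier H" using assms(3) by (simp add: hom_def)
  have "\<exists>\<phi>\<in>hom (fractions_group M) H. \<forall>a\<in>carrier M. \<phi> (fractions_map M a) = f a"
    unfolding fractions_group_def fractions_map_def
  proof (rule presented_group_universal[OF assms(2) f])
    fix r s assume "(r, s) \<in> mult_rel M"
    then obtain a b where ab: "a \<in> carrier M" "b \<in> carrier M"
      "r = [(a, True), (b, True)]" "s = [(a \<otimes>\<^bsub>M\<^esub> b, True)]"
      by (auto simp: mult_rel_def)
    moreover have "f a \<in> carrier H" "f b \<in> carrier H" using ab f by auto
    ultimately show "gword_eval H f r = gword_eval H f s"
      using hom_mult[OF assms(3) ab(1,2)] by (simp add: gword_eval_def)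
  qed
  then obtain \<phi> where \<phi>: "\<phi> \<in> hom (fractions_group M) H" "\<forall>a\<in>carrier M. \<phi> (fractions_map M a) = f a"
    by blast
  have uniq: "\<psi> A = \<phi> A"
    if \<psi>: "\<psi> \<in> hom (fractions_group M) H" "\<forall>a\<in>carrier M. \<psi> (fractions_map M a) = f a"
      and A: "A \<in> carrier (fractions_group M)" for \<psi> A
  proof (rule presented_group_hom_unique[OF assms(2)])
    show "\<psi> \<in> hom (presented_group (carrier M) (mult_rel M)) H"
      using \<psi>(1) by (simp only: fractions_group_def)
    show "\<phi> \<in> hom (presented_group (carrier M) (mult_rel M)) H"
      using \<phi>(1) by (simp only: fractions_group_def)
    show "A \<in> carrier (presented_group (carrier M) (mult_rel M))"
      using A by (simp only: fractions_group_def)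
    show "\<psi> (pres_rel (carrier M) (mult_rel M) `` {[(a, True)]}) =
          \<phi> (pres_rel (carrier M) (mult_rel M) `` {[(a, True)]})" if "a \<in> carrier M" for a
      using \<psi>(2) \<phi>(2) that by (simp only: fractions_map_def)
  qed
  show ?thesis
  proof (intro bexI[OF _ \<phi>(1)] conjI \<phi>(2) ballI impI)
    fix \<psi> A
    assume "\<psi> \<in> hom (fractions_group M) H" "\<forall>a\<in>carrier M. \<psi> (fractions_map M a) = f a"
      "A \<in> carrier (fractions_group M)"
    thus "\<psi> A = \<phi> A" by (rule uniq)
  qed
qed

lemma (in zappa_szep) group_zappa_szep_product: "group (zappa_szep_product F G act res)"
proof (rule groupI)
  let ?Z = "zappa_szep_product F G act res"
  note Z = zappa_szep_product_def
  show "\<one>\<^bsub>?Z\<^esub> \<in> carrier ?Z" by (simp add: Z)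
  show "a \<otimes>\<^bsub>?Z\<^esub> b \<in> carrier ?Z" if "a \<in> carrier ?Z" "b \<in> carrier ?Z" for a b
    using that by (auto simp: Z act_closed res_closed)
  show "a \<otimes>\<^bsub>?Z\<^esub> b \<otimes>\<^bsub>?Z\<^esub> c = a \<otimes>\<^bsub>?Z\<^esub> (b \<otimes>\<^bsub>?Z\<^esub> c)"
    if "a \<in> carrier ?Z" "b \<in> carrier ?Z" "c \<in> carrier ?Z" for a b c
    using that
    by (auto simp: Z act_closed res_closed act_mult mult_act res_mult mult_res F.m_assoc G.m_assoc)
  show "\<one>\<^bsub>?Z\<^esub> \<otimes>\<^bsub>?Z\<^esub> a = a" if "a \<in> carrier ?Z" for a
    using that by (auto simp: Z one_act one_res)
  show "\<exists>b\<in>carrier ?Z. b \<otimes>\<^bsub>?Z\<^esub> a = \<one>\<^bsub>?Z\<^esub>" if a: "a \<in> carrier ?Z" for a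
  proof -
    obtain x g where xg: "a = (x, g)" "x \<in> carrier F" "g \<in> carrier G" using a by (auto simp: Z)
    define k where "k = res (inv\<^bsub>G\<^esub> g) (inv\<^bsub>F\<^esub> x)"
    define y where "y = act (inv\<^bsub>G\<^esub> g) (inv\<^bsub>F\<^esub> x)"
    have c: "k \<in> carrier G" "y \<in> carrier F" using xg by (auto simp: k_def y_def act_closed res_closed)
    have "res k x = inv\<^bsub>G\<^esub> g"
      unfolding k_def using xg by (simp add: res_mult[symmetric] res_one)
    moreover have "y \<otimes>\<^bsub>F\<^esub> act k x = \<one>\<^bsub>F\<^esub>"
      unfolding y_def k_def using xg by (simp add: act_mult[symmetric] act_one)
    ultimately have "(y, k) \<otimes>\<^bsub>?Z\<^esub> a = \<one>\<^bsub>?Z\<^esub>" using xg by (simp add: Z)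
    thus ?thesis using c by (intro bexI[of _ "(y, k)"]) (simp_all add: Z)
  qed
qed

end

theory Submission
  imports Defs
begin

text \<open>Write \<open>F\<close> for the free group on \<open>X\<close> and \<open>G\<close> for the group of units.

  Every element of \<open>M\<close> is uniquely \<open>x g\<close> with \<open>x\<close> a product of generators and \<open>g \<in> G\<close>
  (\<open>factorization_exists\<close>, \<open>factorization_unique\<close>), and \<open>G\<close> permutes the generators up to units on the
  right: \<open>g x = (g \<cdot> x) (g|\<^sub>x)\<close> with \<open>g \<cdot> x \<in> X\<close> (\<open>unit_mult_generator\<close>). So the action of \<open>G\<close> on the
  free monoid is a transducer: it reads a word letter by letter with the current restriction of \<open>g\<close> as
  its state. Symmetry says that each letter permutes the states, hence the transducer can also
  be run on inverse letters. It then sends a cancelling pair to a cancelling pair and returns to the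
  state it started from, so it is well defined on \<open>F\<close>, and the Zappa-Szep laws for letters pass
  to words by induction (\<open>zappa_szep_free_grp\<close>). This gives existence of the extension.

  For any extension, \<open>x g \<mapsto> (x, g)\<close> is a homomorphism from \<open>M\<close> to the group \<open>F \<bowtie> G\<close>
  (\<open>factor_pair_hom\<close>), so it induces \<open>\<phi>\<close> from the group of fractions \<open>U\<close> to \<open>F \<bowtie> G\<close>. In the other
  direction, \<open>F\<close> maps to \<open>U\<close> because it is free, \<open>G\<close> maps to \<open>U\<close> as a part of \<open>M\<close>, and the two maps
  combine to a homomorphism \<open>\<psi>\<close> on \<open>F \<bowtie> G\<close> as soon as their images satisfy the exchange law
  \<open>g x = (g \<cdot> x) (g|\<^sub>x)\<close> (\<open>product_hom\<close>). That law holds in \<open>M\<close> for generators \<open>x\<close>, and the elements of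
  \<open>F\<close> that satisfy it form a subgroup (\<open>exchange_subgroup\<close>). Finally \<open>\<phi>\<close> and \<open>\<psi>\<close> are mutually inverse,
  since both composites fix generators.\<close>

section \<open>Unique factorization in a left Rees monoid\<close>

locale left_rees_transversal = monoid M for M :: "('a, 'b) monoid_scheme" (structure) +
  fixes X :: "'a set"
  assumes left_rees: "left_rees_monoid M"
    and transversal: "is_transversal M X"
begin

lemmas left_rees_conditions = left_rees[unfolded left_rees_monoid_def, THEN conjunct2]

declare Units_closed [simp]

lemma left_cancel:
  "\<lbrakk>a \<in> carrier M; b \<in> carrier M; c \<in> carrier M; a \<otimes> b = a \<otimes> c\<rbrakk> \<Longrightarrow> b = c"
  by (rule left_rees_conditions[THEN conjunct1, rule_format])

lemma right_rigid:
  "\<lbrakk>a \<in> carrier M; b \<in> carrier M; (a <# carrier M) \<inter> (b <# carrier M) \<noteq> {}\<rbrakk> \<Longrightarrow>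
     a <# carrier M \<subseteq> b <# carrier M \<or> b <# carrier M \<subseteq> a <# carrier M"
  by (rule left_rees_conditions[THEN conjunct2, THEN conjunct1, rule_format])

lemma finite_principal_above:
  "a \<in> carrier M \<Longrightarrow> finite {I. \<exists>b\<in>carrier M. I = b <# carrier M \<and> a <# carrier M \<subset> I}"
  by (rule left_rees_conditions[THEN conjunct2, THEN conjunct2, THEN conjunct1, rule_format])

lemma principal_iff: "y \<in> a <# carrier M \<longleftrightarrow> (\<exists>c\<in>carrier M. y = a \<otimes> c)"
  by (auto simp: l_coset_def)

lemma principal_self: "a \<in> carrier M \<Longrightarrow> a \<in> a <# carrier M"
  unfolding principal_iff by (rule bexI[of _ \<one>]) auto

lemma principal_subset_iff:
  assumes "a \<in> carrier M" "b \<in> carrier M"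
  shows "a <# carrier M \<subseteq> b <# carrier M \<longleftrightarrow> (\<exists>c\<in>carrier M. a = b \<otimes> c)"
proof
  assume "a <# carrier M \<subseteq> b <# carrier M"
  then show "\<exists>c\<in>carrier M. a = b \<otimes> c" using principal_self[OF assms(1)] principal_iff by blast
next
  assume "\<exists>c\<in>carrier M. a = b \<otimes> c"
  then obtain c where c: "c \<in> carrier M" "a = b \<otimes> c" by blast
  show "a <# carrier M \<subseteq> b <# carrier M"
  proof
    fix y assume "y \<in> a <# carrier M"
    then obtain d where "d \<in> carrier M" "y = a \<otimes> d" unfolding principal_iff by blast
    then show "y \<in> b <# carrier M" unfolding principal_iff
      using c assms by (intro bexI[of _ "c \<otimes> d"]) (auto simp: m_assoc)
  qed
qed

lemma principal_subset_carrier: "a \<in> carrier M \<Longrightarrow> a <# carrier M \<subseteq> carrier M"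
  by (auto simp: principal_iff)

text \<open>Left cancellation makes one-sided inverses two-sided: from \<open>a b = 1\<close> one gets
  \<open>a (b a) = a 1\<close>.\<close>

lemma right_invertible_Units:
  assumes "a \<in> carrier M" "b \<in> carrier M" "a \<otimes> b = \<one>"
  shows "a \<in> Units M" "b \<in> Units M"
proof -
  have "a \<otimes> (b \<otimes> a) = a \<otimes> \<one>" using assms by (simp flip: m_assoc)
  then have "b \<otimes> a = \<one>" using assms left_cancel[of a "b \<otimes> a" \<one>] by simp
  then show "a \<in> Units M" "b \<in> Units M" using assms unfolding Units_def by blast+
qed

lemma Units_mult_left:
  assumes "a \<in> carrier M" "b \<in> carrier M" "a \<otimes> b \<in> Units M"
  shows "a \<in> Units M"
proof (rule right_invertible_Units(1)[of a "b \<otimes> inv (a \<otimes> b)"])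
  show "a \<otimes> (b \<otimes> inv (a \<otimes> b)) = \<one>" using assms by (simp flip: m_assoc)
qed (use assms in auto)

lemma principal_eq_carrier_iff:
  assumes "a \<in> carrier M"
  shows "a <# carrier M = carrier M \<longleftrightarrow> a \<in> Units M"
proof
  assume "a <# carrier M = carrier M"
  then have "\<one> \<in> a <# carrier M" by simp
  then show "a \<in> Units M" unfolding principal_iff using right_invertible_Units assms by metis
next
  assume a: "a \<in> Units M"
  have "y \<in> a <# carrier M" if "y \<in> carrier M" for y
    unfolding principal_iff using that a assms
    by (intro bexI[of _ "inv a \<otimes> y"]) (auto simp flip: m_assoc)
  then show "a <# carrier M = carrier M" using principal_subset_carrier[OF assms] by blast
qed

lemma principal_eq_unit:
  assumes "a \<in> carrier M" "b \<in> carrier M" "a <# carrier M = b <# carrier M"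
  shows "\<exists>u\<in>Units M. a = b \<otimes> u"
proof -
  obtain c d where c: "c \<in> carrier M" "a = b \<otimes> c" and d: "d \<in> carrier M" "b = a \<otimes> d"
    using principal_subset_iff[OF assms(1,2)] principal_subset_iff[OF assms(2,1)] assms(3) by auto
  have "b \<otimes> (c \<otimes> d) = b \<otimes> \<one>" using c d assms by (simp flip: m_assoc)
  then have "c \<otimes> d = \<one>" using left_cancel c d assms by (metis m_closed one_closed)
  then show ?thesis using right_invertible_Units c d by blast
qed

text \<open>Maximality of \<open>a M\<close> among proper principal right ideals is irreducibility of \<open>a\<close>, a condition
  on elements that is visibly invariant under multiplication by units.\<close>

lemma maximal_generator_iff_irreducible:
  "maximal_generator M a \<longleftrightarrow> a \<in> carrier M \<and> a \<notin> Units M \<and>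
     (\<forall>b\<in>carrier M. \<forall>c\<in>carrier M. a = b \<otimes> c \<longrightarrow> b \<in> Units M \<or> c \<in> Units M)"
    (is "?L \<longleftrightarrow> ?R")
proof
  assume L: ?L
  then have a: "a \<in> carrier M" "a \<notin> Units M"
    unfolding maximal_generator_def using principal_eq_carrier_iff by blast+
  have "b \<in> Units M \<or> c \<in> Units M" if bc: "b \<in> carrier M" "c \<in> carrier M" "a = b \<otimes> c" for b c
  proof (cases "a <# carrier M = b <# carrier M")
    case True
    then obtain u where "u \<in> Units M" "a = b \<otimes> u" using principal_eq_unit a bc by blast
    then show ?thesis using left_cancel[of b c u] bc by auto
  next
    case False
    then have "a <# carrier M \<subset> b <# carrier M" using principal_subset_iff a bc by blast
    then show ?thesis using L bc unfolding maximal_generator_def by (simp add: principal_eq_carrier_iff)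
  qed
  with a show ?R by blast
next
  assume R: ?R
  have "b <# carrier M = carrier M" if b: "b \<in> carrier M" "a <# carrier M \<subset> b <# carrier M" for b
  proof -
    obtain c where c: "c \<in> carrier M" "a = b \<otimes> c" using b R principal_subset_iff[of a b] by blast
    have "c \<notin> Units M"
    proof
      assume "c \<in> Units M"
      then have "b = a \<otimes> inv c" using c b by (simp add: m_assoc)
      then have "b <# carrier M \<subseteq> a <# carrier M"
        using principal_subset_iff[of b a] \<open>c \<in> Units M\<close> b R by blast
      then show False using b by blast
    qed
    then show ?thesis using R b c principal_eq_carrier_iff by blast
  qed
  with R show ?L unfolding maximal_generator_def by (simp add: principal_eq_carrier_iff)
qed

lemma X_maximal: "x \<in> X \<Longrightarrow> maximal_generator M x"
  using transversal by (simp add: is_transversal_def)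

lemma X_closed [simp]: "x \<in> X \<Longrightarrow> x \<in> carrier M"
  using X_maximal by (simp add: maximal_generator_def)

lemma X_not_unit: "x \<in> X \<Longrightarrow> x \<notin> Units M"
  using X_maximal by (simp add: maximal_generator_iff_irreducible)

lemma maximal_generator_factor:
  assumes "maximal_generator M a"
  shows "\<exists>x\<in>X. \<exists>u\<in>Units M. a = x \<otimes> u"
proof -
  obtain x where x: "x \<in> X" "x <# carrier M = a <# carrier M"
    using transversal assms unfolding is_transversal_def by blast
  moreover have "a \<in> carrier M" using assms by (simp add: maximal_generator_def)
  ultimately show ?thesis using principal_eq_unit[of a x] by auto
qed

text \<open>Two generators dividing a common element on the left generate comparable, hence equal, maximal
  right ideals; this is where right rigidity enters.\<close>

lemma X_eq_if_common_multiple: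
  assumes "x \<in> X" "y \<in> X" "c \<in> carrier M" "d \<in> carrier M" "x \<otimes> c = y \<otimes> d"
  shows "x = y"
proof -
  have "x \<otimes> c \<in> (x <# carrier M) \<inter> (y <# carrier M)"
    unfolding Int_iff principal_iff using assms(3-5) by metis
  then have "x <# carrier M \<subseteq> y <# carrier M \<or> y <# carrier M \<subseteq> x <# carrier M"
    using right_rigid[of x y] assms by auto
  then have "x <# carrier M = y <# carrier M"
    using X_maximal[OF assms(1)] X_maximal[OF assms(2)] unfolding maximal_generator_def psubset_eq
    by metis
  moreover have "\<exists>!z. z \<in> X \<and> z <# carrier M = x <# carrier M"
    using transversal X_maximal[OF assms(1)] unfolding is_transversal_def by simp
  ultimately show ?thesis using assms(1,2) by auto
qed

text \<open>The finiteness condition provides a maximal right ideal above any proper principal one.\<close>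

lemma nonunit_factor:
  assumes "a \<in> carrier M" "a \<notin> Units M"
  shows "\<exists>x\<in>X. \<exists>c\<in>carrier M. a = x \<otimes> c"
proof -
  define T where "T = {I. \<exists>b\<in>carrier M. I = b <# carrier M \<and> a <# carrier M \<subseteq> I \<and> I \<noteq> carrier M}"
  have "T \<subseteq> insert (a <# carrier M) {I. \<exists>b\<in>carrier M. I = b <# carrier M \<and> a <# carrier M \<subset> I}"
    unfolding T_def by auto
  then have "finite T"
    by (rule finite_subset) (unfold finite_insert, rule finite_principal_above[OF assms(1)])
  moreover have "a <# carrier M \<in> T"
    unfolding T_def using assms principal_eq_carrier_iff by auto
  ultimately obtain I where I: "I \<in> T" and max: "\<And>J. J \<in> T \<Longrightarrow> I \<subseteq> J \<Longrightarrow> I = J"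
    using finite_has_maximal[of T] by auto
  from I obtain b where b: "b \<in> carrier M" "I = b <# carrier M"
    and Ia: "a <# carrier M \<subseteq> I" and I_proper: "I \<noteq> carrier M"
    unfolding T_def by auto
  have "maximal_generator M b"
    unfolding maximal_generator_def
  proof (intro conjI ballI impI)
    show "b <# carrier M \<noteq> carrier M" using b I_proper by simp
    fix c assume c: "c \<in> carrier M" "b <# carrier M \<subset> c <# carrier M"
    show "c <# carrier M = carrier M"
    proof (rule ccontr)
      assume "c <# carrier M \<noteq> carrier M"
      then have "c <# carrier M \<in> T" unfolding T_def using c b Ia by auto
      then show False using max c b by blast
    qed
  qed (rule b)
  then obtain x u where x: "x \<in> X" "u \<in> Units M" "b = x \<otimes> u" using maximal_generator_factor by blast
  obtain d where "d \<in> carrier M" "a = b \<otimes> d" using Ia assms b principal_subset_iff by blast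
  then have "a = x \<otimes> (u \<otimes> d)" "u \<otimes> d \<in> carrier M" using x by (auto simp: m_assoc)
  then show ?thesis using x by blast
qed

abbreviation word_prod :: "'a list \<Rightarrow> 'a" where
  "word_prod xs \<equiv> foldr (\<otimes>) xs \<one>"

lemma word_prod_closed [simp]: "xs \<in> lists X \<Longrightarrow> word_prod xs \<in> carrier M"
  by (induction xs) auto

declare word_prod_closed [unfolded in_lists_conv_set, simp]

lemma word_prod_append:
  "\<lbrakk>xs \<in> lists X; ys \<in> lists X\<rbrakk> \<Longrightarrow> word_prod (xs @ ys) = word_prod xs \<otimes> word_prod ys"
  by (induction xs) (auto simp: m_assoc)

text \<open>Splitting off a generator \<open>x\<close> from \<open>a = x c\<close> decreases the number of principal right ideals
  strictly above: \<open>I \<mapsto> x I\<close> maps those above \<open>c M\<close> injectively to those above \<open>a M\<close>, and misses \<open>M\<close>.\<close>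

lemma factorization_exists:
  assumes "a \<in> carrier M"
  shows "\<exists>xs\<in>lists X. \<exists>g\<in>Units M. a = word_prod xs \<otimes> g"
proof -
  define S where "S a = {I. \<exists>b\<in>carrier M. I = b <# carrier M \<and> a <# carrier M \<subset> I}" for a
  have fin: "finite (S a)" if "a \<in> carrier M" for a
    unfolding S_def using finite_principal_above that by blast
  have decr: "card (S c) < card (S (x \<otimes> c))" if x: "x \<in> X" and c: "c \<in> carrier M" for x c
  proof -
    let ?f = "\<lambda>I. (\<otimes>) x ` I"
    have inj: "inj_on ?f (S c)"
    proof (rule inj_onI)
      fix I J assume "I \<in> S c" "J \<in> S c" and eq: "?f I = ?f J"
      then have "I \<subseteq> carrier M" "J \<subseteq> carrier M"
        unfolding S_def using principal_subset_carrier by blast+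
      moreover have "inj_on ((\<otimes>) x) (carrier M)"
        using left_cancel x by (meson X_closed inj_onI)
      ultimately show "I = J" using eq inj_on_image_eq_iff by metis
    qed
    have img: "?f (b <# carrier M) = (x \<otimes> b) <# carrier M" if "b \<in> carrier M" for b
      using that x by (auto simp: l_coset_def m_assoc)
    have sub: "?f ` S c \<subseteq> S (x \<otimes> c) - {carrier M}"
    proof
      fix J assume "J \<in> ?f ` S c"
      then obtain b where b: "b \<in> carrier M" "c <# carrier M \<subset> b <# carrier M"
        and J: "J = (x \<otimes> b) <# carrier M"
        unfolding S_def using img by blast
      have "\<exists>d\<in>carrier M. c = b \<otimes> d" using b c principal_subset_iff by blast
      then have "x \<otimes> c \<in> J" unfolding J principal_iff using x b by (auto simp: m_assoc)
      then have 1: "(x \<otimes> c) <# carrier M \<subseteq> J"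
        unfolding J using principal_subset_iff[of "x \<otimes> c" "x \<otimes> b"] x b c by (simp add: principal_iff)
      have 2: "(x \<otimes> c) <# carrier M \<noteq> J"
      proof
        assume "(x \<otimes> c) <# carrier M = J"
        then have "x \<otimes> b \<in> (x \<otimes> c) <# carrier M" unfolding J using principal_self x b by simp
        then obtain d where d: "d \<in> carrier M" "x \<otimes> b = x \<otimes> c \<otimes> d"
          unfolding principal_iff by (elim bexE)
        then have "b = c \<otimes> d" using left_cancel[of x b "c \<otimes> d"] x b c by (simp add: m_assoc)
        then have "b <# carrier M \<subseteq> c <# carrier M" using principal_subset_iff b c d by blast
        then show False using b by blast
      qed
      have "J \<noteq> carrier M"
        unfolding J using principal_eq_carrier_iff[of "x \<otimes> b"] Units_mult_left[of x b] X_not_unit x b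
        by auto
      with 1 2 show "J \<in> S (x \<otimes> c) - {carrier M}" unfolding S_def using J x b by auto
    qed
    have "x \<otimes> c \<notin> Units M" using Units_mult_left[of x c] X_not_unit x c by auto
    then have "(x \<otimes> c) <# carrier M \<subset> carrier M"
      using principal_eq_carrier_iff[of "x \<otimes> c"] principal_subset_carrier[of "x \<otimes> c"] x c by auto
    moreover have "carrier M = \<one> <# carrier M" using principal_eq_carrier_iff[of \<one>] by simp
    ultimately have "carrier M \<in> S (x \<otimes> c)" unfolding S_def by blast
    moreover have "card (?f ` S c) \<le> card (S (x \<otimes> c) - {carrier M})"
      using sub fin[of "x \<otimes> c"] x c by (intro card_mono) auto
    ultimately show ?thesis using fin[of "x \<otimes> c"] x c card_image[OF inj] card_Diff1_less
      by (metis (no_types, lifting) X_closed m_closed order.strict_trans1)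
  qed
  show ?thesis using assms
  proof (induction "card (S a)" arbitrary: a rule: less_induct)
    case less
    show ?case
    proof (cases "a \<in> Units M")
      case True
      then show ?thesis by (intro bexI[of _ "[]"] bexI[of _ a]) auto
    next
      case False
      then obtain x c where x: "x \<in> X" "c \<in> carrier M" "a = x \<otimes> c"
        using nonunit_factor less.prems by blast
      then obtain xs g where "xs \<in> lists X" "g \<in> Units M" "c = word_prod xs \<otimes> g"
        using less.hyps decr by blast
      then show ?thesis using x by (intro bexI[of _ "x # xs"] bexI[of _ g]) (auto simp: m_assoc)
    qed
  qed
qed

lemma factorization_unique:
  assumes "xs \<in> lists X" "ys \<in> lists X" "g \<in> Units M" "h \<in> Units M"
    and "word_prod xs \<otimes> g = word_prod ys \<otimes> h"
  shows "xs = ys \<and> g = h"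
  using assms
proof (induction xs arbitrary: ys)
  case Nil
  show ?case
  proof (cases ys)
    case ys: Nil
    then show ?thesis using Nil.prems by simp
  next
    case ys: (Cons y zs)
    then have y: "y \<in> X" "zs \<in> lists X" using Nil.prems by simp_all
    have "y \<otimes> (word_prod zs \<otimes> h) = g" using Nil.prems(3,4) y by (simp add: ys m_assoc Nil.prems(2))
    then have "y \<in> Units M" using Units_mult_left[of y "word_prod zs \<otimes> h"] Nil.prems(2,3) y by simp
    then show ?thesis using X_not_unit y by simp
  qed
next
  case (Cons x xs)
  from Cons.hyps have x: "x \<in> X" "xs \<in> lists X" by simp_all
  have eq: "x \<otimes> (word_prod xs \<otimes> g) = word_prod ys \<otimes> h"
    using Cons.prems(4) x Cons.prems(2) by (simp add: m_assoc)
  show ?case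
  proof (cases ys)
    case ys: Nil
    have "x \<in> Units M"
      using Units_mult_left[of x "word_prod xs \<otimes> g"] x Cons.prems(2,3) eq by (simp add: ys)
    then show ?thesis using X_not_unit x by simp
  next
    case ys: (Cons y zs)
    with Cons.prems have y: "y \<in> X" "zs \<in> lists X" by simp_all
    have eq': "x \<otimes> (word_prod xs \<otimes> g) = y \<otimes> (word_prod zs \<otimes> h)"
      using eq y Cons.prems(3) by (simp add: ys m_assoc)
    have xy: "x = y"
      by (rule X_eq_if_common_multiple[OF x(1) y(1) _ _ eq']) (use x y Cons.prems in simp_all)
    have "word_prod xs \<otimes> g = word_prod zs \<otimes> h"
      by (rule left_cancel[OF _ _ _ eq'[folded xy]]) (use x y Cons.prems in simp_all)
    then show ?thesis using Cons.IH[OF y(2) Cons.prems(2,3)] xy ys by simp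
  qed
qed

lemma star_eq: "star M X = word_prod ` lists X"
proof
  have "submonoid (word_prod ` lists X) M"
  proof
    show "word_prod ` lists X \<subseteq> carrier M" using word_prod_closed by blast
    show "\<one> \<in> word_prod ` lists X" by (rule image_eqI[of _ _ "[]"]) auto
    fix a b assume "a \<in> word_prod ` lists X" "b \<in> word_prod ` lists X"
    then obtain xs ys where *: "xs \<in> lists X" "ys \<in> lists X" "a = word_prod xs" "b = word_prod ys"
      by blast
    then have "a \<otimes> b = word_prod (xs @ ys)" "xs @ ys \<in> lists X"
      using word_prod_append by (simp_all only: append_in_lists_conv simp_thms)
    then show "a \<otimes> b \<in> word_prod ` lists X" by blast
  qed
  moreover have "x \<in> word_prod ` lists X" if "x \<in> X" for x
    using that by (intro image_eqI[of _ _ "[x]"]) auto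
  ultimately show "star M X \<subseteq> word_prod ` lists X" unfolding star_def by blast
next
  have "word_prod xs \<in> N" if "submonoid N M" "X \<subseteq> N" "xs \<in> lists X" for N xs
  proof -
    interpret N: submonoid N M by (rule that)
    show ?thesis using that(3,2) by (induction xs) (auto intro: N.m_closed)
  qed
  then show "word_prod ` lists X \<subseteq> star M X" unfolding star_def by blast
qed

lemma dot_eqI:
  assumes "g \<otimes> a = word_prod ys \<otimes> h" "ys \<in> lists X" "h \<in> Units M"
  shows "dot M X g a = word_prod ys"
  unfolding dot_def star_eq
proof (rule the_equality)
  show "word_prod ys \<in> word_prod ` lists X \<and> (\<exists>h\<in>Units M. g \<otimes> a = word_prod ys \<otimes> h)"
    using assms by blast
  fix y assume "y \<in> word_prod ` lists X \<and> (\<exists>h\<in>Units M. g \<otimes> a = y \<otimes> h)"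
  then obtain zs k where "zs \<in> lists X" "k \<in> Units M" "y = word_prod zs" "g \<otimes> a = word_prod zs \<otimes> k"
    by blast
  then show "y = word_prod ys" using assms factorization_unique[of zs ys k h] by simp
qed

lemma restr_eqI:
  assumes "g \<otimes> a = word_prod ys \<otimes> h" "ys \<in> lists X" "h \<in> Units M"
  shows "restr M X g a = h"
  unfolding restr_def star_eq
proof (rule the_equality)
  show "h \<in> Units M \<and> (\<exists>y\<in>word_prod ` lists X. g \<otimes> a = y \<otimes> h)" using assms by blast
  fix k assume "k \<in> Units M \<and> (\<exists>y\<in>word_prod ` lists X. g \<otimes> a = y \<otimes> k)"
  then obtain zs where "zs \<in> lists X" "k \<in> Units M" "g \<otimes> a = word_prod zs \<otimes> k" by blast
  then show "k = h" using assms factorization_unique[of zs ys k h] by simp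
qed

lemma unit_mult_star:
  assumes "g \<in> Units M" "xs \<in> lists X"
  obtains ys where "ys \<in> lists X" "dot M X g (word_prod xs) = word_prod ys"
    "restr M X g (word_prod xs) \<in> Units M"
    "g \<otimes> word_prod xs = word_prod ys \<otimes> restr M X g (word_prod xs)"
proof -
  obtain ys h where *: "ys \<in> lists X" "h \<in> Units M" "g \<otimes> word_prod xs = word_prod ys \<otimes> h"
    using factorization_exists[of "g \<otimes> word_prod xs"] assms by auto
  then show thesis using that dot_eqI restr_eqI by metis
qed

text \<open>Units preserve irreducibility, so \<open>g x\<close> for \<open>x \<in> X\<close> generates a maximal proper right ideal,
  and the \<open>star\<close> part of its factorization is again a single generator.\<close>

lemma unit_mult_generator:
  assumes "g \<in> Units M" "x \<in> X"
  shows "dot M X g x \<in> X" "restr M X g x \<in> Units M" "g \<otimes> x = dot M X g x \<otimes> restr M X g x"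
proof -
  have g: "g \<in> carrier M" "inv g \<in> Units M" using assms by auto
  have "maximal_generator M (g \<otimes> x)"
    unfolding maximal_generator_iff_irreducible
  proof (intro conjI ballI impI)
    have x_eq: "x = inv g \<otimes> (g \<otimes> x)" using assms g by (simp flip: m_assoc)
    show "g \<otimes> x \<notin> Units M" using x_eq X_not_unit[OF assms(2)] g by (metis Units_m_closed)
    fix b c assume bc: "b \<in> carrier M" "c \<in> carrier M" "g \<otimes> x = b \<otimes> c"
    then have "x = (inv g \<otimes> b) \<otimes> c" using x_eq g by (simp add: m_assoc)
    then have "inv g \<otimes> b \<in> Units M \<or> c \<in> Units M"
      using X_maximal[OF assms(2)] bc g unfolding maximal_generator_iff_irreducible by auto
    moreover have "b = g \<otimes> (inv g \<otimes> b)" using assms g bc by (simp flip: m_assoc)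
    ultimately show "b \<in> Units M \<or> c \<in> Units M" using assms(1) by (metis Units_m_closed)
  qed (use assms g in auto)
  then obtain y u where y: "y \<in> X" "u \<in> Units M" "g \<otimes> x = y \<otimes> u"
    using maximal_generator_factor by blast
  then have e: "g \<otimes> x = word_prod [y] \<otimes> u" by auto
  show "dot M X g x \<in> X" "restr M X g x \<in> Units M" "g \<otimes> x = dot M X g x \<otimes> restr M X g x"
    using dot_eqI[OF e] restr_eqI[OF e] y by auto
qed

end

section \<open>Extending an action on letters to the free group\<close>

text \<open>The Zappa-Szep laws that concern a single letter, together with the symmetry condition that
  reading a letter permutes the group.\<close>

locale symmetric_letter_action = group G for G :: "('g, 'n) monoid_scheme" (structure) +
  fixes X :: "'x set" and d :: "'g \<Rightarrow> 'x \<Rightarrow> 'x" and r :: "'g \<Rightarrow> 'x \<Rightarrow> 'g"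
  assumes d_closed: "\<lbrakk>g \<in> carrier G; x \<in> X\<rbrakk> \<Longrightarrow> d g x \<in> X"
    and d_one: "x \<in> X \<Longrightarrow> d \<one> x = x"
    and d_mult: "\<lbrakk>g \<in> carrier G; h \<in> carrier G; x \<in> X\<rbrakk> \<Longrightarrow> d (g \<otimes> h) x = d g (d h x)"
    and r_one: "x \<in> X \<Longrightarrow> r \<one> x = \<one>"
    and r_mult: "\<lbrakk>g \<in> carrier G; h \<in> carrier G; x \<in> X\<rbrakk> \<Longrightarrow> r (g \<otimes> h) x = r g (d h x) \<otimes> r h x"
    and r_bij: "x \<in> X \<Longrightarrow> bij_betw (\<lambda>g. r g x) (carrier G) (carrier G)"
begin

lemma r_closed: "\<lbrakk>g \<in> carrier G; x \<in> X\<rbrakk> \<Longrightarrow> r g x \<in> carrier G"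
  using r_bij bij_betwE by fast

lemma r_surj: "\<lbrakk>g \<in> carrier G; x \<in> X\<rbrakk> \<Longrightarrow> \<exists>k\<in>carrier G. g = r k x"
  using r_bij[of x] unfolding bij_betw_def by auto

definition r_inv :: "'x \<Rightarrow> 'g \<Rightarrow> 'g" where
  "r_inv x = inv_into (carrier G) (\<lambda>h. r h x)"

lemma r_inv_r: "\<lbrakk>k \<in> carrier G; x \<in> X\<rbrakk> \<Longrightarrow> r_inv x (r k x) = k"
  unfolding r_inv_def using r_bij bij_betw_imp_inj_on by (intro inv_into_f_f) auto

text \<open>On an inverse letter the values are forced: if \<open>g = k|\<^sub>x\<close>, then \<open>1 = k \<cdot> (x x\<^sup>-\<^sup>1)\<close> makes
  \<open>g \<cdot> x\<^sup>-\<^sup>1\<close> the inverse of \<open>k \<cdot> x\<close>, and \<open>k = k|\<^bsub>x x\<^sup>-\<^sup>1\<^esub>\<close> makes \<open>k\<close> the restriction of \<open>g\<close> to \<open>x\<^sup>-\<^sup>1\<close>.\<close>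

definition letter_act :: "'g \<Rightarrow> 'x \<times> bool \<Rightarrow> 'x \<times> bool" where
  "letter_act g l = (case l of (x, b) \<Rightarrow> (d (if b then g else r_inv x g) x, b))"

definition letter_res :: "'g \<Rightarrow> 'x \<times> bool \<Rightarrow> 'g" where
  "letter_res g l = (case l of (x, b) \<Rightarrow> if b then r g x else r_inv x g)"

lemma letter_pos [simp]:
  "letter_act g (x, True) = (d g x, True)" "letter_res g (x, True) = r g x"
  by (simp_all add: letter_act_def letter_res_def)

lemma letter_neg:
  assumes "k \<in> carrier G" "x \<in> X"
  shows "letter_act (r k x) (x, False) = (d k x, False)" "letter_res (r k x) (x, False) = k"
  using assms by (simp_all add: letter_act_def letter_res_def r_inv_r)

lemma neg_letter_cases:
  assumes "g \<in> carrier G" "x \<in> X"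
  obtains k where "k \<in> carrier G" "g = r k x"
    "letter_act g (x, False) = (d k x, False)" "letter_res g (x, False) = k"
  using r_surj[OF assms] letter_neg assms(2) by metis

lemma letter_closed:
  assumes "g \<in> carrier G" "l \<in> X \<times> UNIV"
  shows "letter_act g l \<in> X \<times> UNIV" "letter_res g l \<in> carrier G"
proof -
  obtain x b where l: "l = (x, b)" "x \<in> X" using assms by auto
  have "letter_act g l \<in> X \<times> UNIV \<and> letter_res g l \<in> carrier G"
  proof (cases b)
    case True
    then show ?thesis using l assms by (simp add: d_closed r_closed)
  next
    case False
    obtain k where "k \<in> carrier G" "letter_act g (x, False) = (d k x, False)" "letter_res g (x, False) = k"
      using neg_letter_cases[OF assms(1) l(2)] by metis
    then show ?thesis using l False by (simp add: d_closed)
  qed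
  then show "letter_act g l \<in> X \<times> UNIV" "letter_res g l \<in> carrier G" by auto
qed

lemma letter_one:
  assumes "l \<in> X \<times> UNIV"
  shows "letter_act \<one> l = l" "letter_res \<one> l = \<one>"
proof -
  obtain x b where l: "l = (x, b)" "x \<in> X" using assms by auto
  then have "letter_act \<one> l = l \<and> letter_res \<one> l = \<one>"
    using letter_neg[of \<one> x] by (cases b) (simp_all add: d_one r_one)
  then show "letter_act \<one> l = l" "letter_res \<one> l = \<one>" by auto
qed

lemma letter_mult:
  assumes "g \<in> carrier G" "h \<in> carrier G" "l \<in> X \<times> UNIV"
  shows "letter_act (g \<otimes> h) l = letter_act g (letter_act h l)"
    and "letter_res (g \<otimes> h) l = letter_res g (letter_act h l) \<otimes> letter_res h l"
proof -
  obtain x b where l: "l = (x, b)" "x \<in> X" using assms by auto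
  have "letter_act (g \<otimes> h) l = letter_act g (letter_act h l) \<and>
    letter_res (g \<otimes> h) l = letter_res g (letter_act h l) \<otimes> letter_res h l"
  proof (cases b)
    case True
    then show ?thesis using l assms by (simp add: d_mult r_mult)
  next
    case False
    obtain k where k: "k \<in> carrier G" "h = r k x"
      "letter_act h (x, False) = (d k x, False)" "letter_res h (x, False) = k"
      using neg_letter_cases[OF assms(2) l(2)] by metis
    obtain m where m: "m \<in> carrier G" "g = r m (d k x)"
      "letter_act g (d k x, False) = (d m (d k x), False)" "letter_res g (d k x, False) = m"
      using neg_letter_cases[OF assms(1) d_closed[OF k(1) l(2)]] by metis
    have "g \<otimes> h = r (m \<otimes> k) x" using k m l by (simp add: r_mult)
    then have "letter_act (g \<otimes> h) (x, False) = (d (m \<otimes> k) x, False)"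
      "letter_res (g \<otimes> h) (x, False) = m \<otimes> k"
      using letter_neg[of "m \<otimes> k" x] k m l by simp_all
    then show ?thesis using l False k m by (simp add: d_mult)
  qed
  then show "letter_act (g \<otimes> h) l = letter_act g (letter_act h l)"
    and "letter_res (g \<otimes> h) l = letter_res g (letter_act h l) \<otimes> letter_res h l" by auto
qed

text \<open>The transducer: \<open>g\<close> is its state, \<open>word_act\<close> its output and \<open>word_res\<close> the state it ends in.\<close>

fun word_act :: "'g \<Rightarrow> 'x gword \<Rightarrow> 'x gword" where
  "word_act g [] = []"
| "word_act g (l # w) = letter_act g l # word_act (letter_res g l) w"

fun word_res :: "'g \<Rightarrow> 'x gword \<Rightarrow> 'g" where
  "word_res g [] = g"
| "word_res g (l # w) = word_res (letter_res g l) w"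

lemma word_act_closed: "\<lbrakk>g \<in> carrier G; w \<in> gwords X\<rbrakk> \<Longrightarrow> word_act g w \<in> gwords X"
proof (induction w arbitrary: g rule: list.induct)
  case (Cons l w)
  then have "l \<in> X \<times> UNIV" "w \<in> gwords X" by simp_all
  then show ?case using Cons letter_closed[of g l] by simp
qed simp

lemma word_res_closed: "\<lbrakk>g \<in> carrier G; w \<in> gwords X\<rbrakk> \<Longrightarrow> word_res g w \<in> carrier G"
proof (induction w arbitrary: g rule: list.induct)
  case (Cons l w)
  then have "l \<in> X \<times> UNIV" "w \<in> gwords X" by simp_all
  then show ?case using Cons letter_closed[of g l] by simp
qed simp

lemma word_act_append: "word_act g (u @ v) = word_act g u @ word_act (word_res g u) v"
  by (induction u arbitrary: g) auto

lemma word_res_append: "word_res g (u @ v) = word_res (word_res g u) v"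
  by (induction u arbitrary: g) auto

lemma word_one: "w \<in> gwords X \<Longrightarrow> word_act \<one> w = w \<and> word_res \<one> w = \<one>"
proof (induction w rule: list.induct)
  case (Cons l w)
  then have "l \<in> X \<times> UNIV" "w \<in> gwords X" by simp_all
  then show ?case using Cons letter_one[of l] by simp
qed simp

lemma word_mult:
  "\<lbrakk>g \<in> carrier G; h \<in> carrier G; w \<in> gwords X\<rbrakk> \<Longrightarrow>
     word_act (g \<otimes> h) w = word_act g (word_act h w) \<and>
     word_res (g \<otimes> h) w = word_res g (word_act h w) \<otimes> word_res h w"
proof (induction w arbitrary: g h rule: list.induct)
  case (Cons l w)
  then have l: "l \<in> X \<times> UNIV" "w \<in> gwords X" by simp_all
  note c = letter_closed[OF Cons.prems(2) l(1)]
  show ?case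
    using Cons.IH[OF letter_closed(2)[OF Cons.prems(1) c(1)] c(2) l(2)]
      letter_mult[OF Cons.prems(1,2) l(1)] by simp
qed simp

text \<open>Reading \<open>x x\<^sup>-\<^sup>1\<close> or \<open>x\<^sup>-\<^sup>1 x\<close> restores \<open>g\<close> and outputs a cancelling pair, so word equivalence in the
  free group is respected.\<close>

lemma word_cancel:
  assumes "g \<in> carrier G" "x \<in> X"
  obtains y where "y \<in> X" "word_act g [(x, b), (x, \<not> b)] = [(y, b), (y, \<not> b)]"
    "word_res g [(x, b), (x, \<not> b)] = g"
proof (cases b)
  case True
  then show ?thesis using that[of "d g x"] assms letter_neg[OF assms] by (simp add: d_closed)
next
  case False
  obtain k where "k \<in> carrier G" "g = r k x"
    "letter_act g (x, False) = (d k x, False)" "letter_res g (x, False) = k"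
    using neg_letter_cases[OF assms] by metis
  then show ?thesis using that[of "d k x"] assms False by (simp add: d_closed)
qed

lemma word_pres_rel:
  assumes "(u, v) \<in> pres_rel X {}" "g \<in> carrier G"
  shows "(word_act g u, word_act g v) \<in> pres_rel X {} \<and> word_res g u = word_res g v"
  using assms
proof (induction arbitrary: g rule: pres_rel.induct)
  case (refl w)
  then show ?case by (simp add: pres_rel.refl word_act_closed)
next
  case (sym u v)
  then show ?case by (simp add: pres_rel.sym)
next
  case (trans u v w)
  from pres_rel.trans[OF trans.IH(1)[THEN conjunct1] trans.IH(2)[THEN conjunct1]] trans
  show ?case by simp
next
  case (cancel u v x b)
  define k where "k = word_res g u"
  have k: "k \<in> carrier G" using cancel word_res_closed by (simp add: k_def)
  obtain y where y: "y \<in> X" "word_act k [(x, b), (x, \<not> b)] = [(y, b), (y, \<not> b)]"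
    "word_res k [(x, b), (x, \<not> b)] = k"
    using word_cancel[OF k cancel.hyps(3)] by metis
  have "(word_act g u @ [(y, b), (y, \<not> b)] @ word_act k v, word_act g u @ word_act k v) \<in> pres_rel X {}"
    by (rule pres_rel.cancel[OF word_act_closed[OF cancel.prems cancel.hyps(1)]
          word_act_closed[OF k cancel.hyps(2)] y(1)])
  then show ?case
    unfolding word_act_append word_res_append k_def[symmetric] y by simp
next
  case (rel u v p q)
  then show ?case by simp
qed

abbreviation free_class :: "'x gword \<Rightarrow> 'x gword set" where
  "free_class w \<equiv> pres_rel X {} `` {w}"

definition free_act :: "'g \<Rightarrow> 'x gword set \<Rightarrow> 'x gword set" where
  "free_act g A = (\<Union>w\<in>A. free_class (word_act g w))"

definition free_res :: "'g \<Rightarrow> 'x gword set \<Rightarrow> 'g" where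
  "free_res g A = the_elem (word_res g ` A)"

lemma free_act_class:
  assumes "g \<in> carrier G" "w \<in> gwords X"
  shows "free_act g (free_class w) = free_class (word_act g w)"
  unfolding free_act_def
proof (rule UN_equiv_class[OF equiv_pres_rel _ assms(2)])
  show "(\<lambda>w. free_class (word_act g w)) respects pres_rel X {}"
    using word_pres_rel[OF _ assms(1)] by (intro congruentI equiv_class_eq[OF equiv_pres_rel]) simp
qed

lemma free_res_class:
  assumes "g \<in> carrier G" "w \<in> gwords X"
  shows "free_res g (free_class w) = word_res g w"
proof -
  have "free_class w \<noteq> {}" using pres_rel.refl[OF assms(2)] by (metis Image_singleton_iff empty_iff)
  moreover have "word_res g ` free_class w = (\<lambda>_. word_res g w) ` free_class w"
    using word_pres_rel[of w _ g] assms(1) by (intro image_cong) simp_all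
  ultimately have "word_res g ` free_class w = {word_res g w}"
    by (simp only: image_constant_conv if_False)
  then show ?thesis by (simp add: free_res_def)
qed

lemma free_grp_cases:
  assumes "A \<in> carrier (free_grp X)"
  obtains w where "w \<in> gwords X" "A = free_class w"
  using assms unfolding free_grp_def by (rule presented_group_cases)

lemma free_class_mult:
  "\<lbrakk>u \<in> gwords X; v \<in> gwords X\<rbrakk> \<Longrightarrow> free_class u \<otimes>\<^bsub>free_grp X\<^esub> free_class v = free_class (u @ v)"
  unfolding free_grp_def by (rule presented_group_mult)

lemma free_class_closed: "w \<in> gwords X \<Longrightarrow> free_class w \<in> carrier (free_grp X)"
  unfolding free_grp_def by (rule presented_group_class)

lemma free_class_one: "\<one>\<^bsub>free_grp X\<^esub> = free_class []"
  unfolding free_grp_def by (rule presented_group_one)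

lemma zappa_szep_free_grp: "zappa_szep (free_grp X) G free_act free_res"
proof (intro zappa_szep.intro zappa_szep_axioms.intro group_free_grp group_axioms)
  fix g A assume g: "g \<in> carrier G" and A: "A \<in> carrier (free_grp X)"
  obtain u where u: "u \<in> gwords X" "A = free_class u" using A by (rule free_grp_cases)
  show "free_act g A \<in> carrier (free_grp X)" "free_res g A \<in> carrier G"
    unfolding u(2) free_act_class[OF g u(1)] free_res_class[OF g u(1)]
    using free_class_closed word_act_closed word_res_closed g u(1) by auto
  fix B assume B: "B \<in> carrier (free_grp X)"
  obtain v where v: "v \<in> gwords X" "B = free_class v" using B by (rule free_grp_cases)
  have uv: "u @ v \<in> gwords X" using u v by simp
  note c = word_act_closed[OF g u(1)] word_res_closed[OF g u(1)]
  show "free_act g (A \<otimes>\<^bsub>free_grp X\<^esub> B) = free_act g A \<otimes>\<^bsub>free_grp X\<^esub> free_act (free_res g A) B"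
    unfolding u(2) v(2) free_class_mult[OF u(1) v(1)] free_act_class[OF g u(1)]
      free_res_class[OF g u(1)] free_act_class[OF g uv] free_act_class[OF c(2) v(1)]
      free_class_mult[OF c(1) word_act_closed[OF c(2) v(1)]] word_act_append ..
  show "free_res g (A \<otimes>\<^bsub>free_grp X\<^esub> B) = free_res (free_res g A) B"
    unfolding u(2) v(2) free_class_mult[OF u(1) v(1)] free_res_class[OF g u(1)]
      free_res_class[OF g uv] free_res_class[OF c(2) v(1)] word_res_append ..
next
  fix g h A assume g: "g \<in> carrier G" and h: "h \<in> carrier G" and A: "A \<in> carrier (free_grp X)"
  obtain u where u: "u \<in> gwords X" "A = free_class u" using A by (rule free_grp_cases)
  note c = word_act_closed[OF h u(1)]
  show "free_act (g \<otimes> h) A = free_act g (free_act h A)"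
    "free_res (g \<otimes> h) A = free_res g (free_act h A) \<otimes> free_res h A"
    unfolding u(2) free_act_class[OF h u(1)] free_res_class[OF h u(1)]
      free_act_class[OF m_closed[OF g h] u(1)] free_res_class[OF m_closed[OF g h] u(1)]
      free_act_class[OF g c] free_res_class[OF g c]
    using word_mult[OF g h u(1)] by simp_all
next
  fix A assume A: "A \<in> carrier (free_grp X)"
  obtain u where u: "u \<in> gwords X" "A = free_class u" using A by (rule free_grp_cases)
  show "free_act \<one> A = A" "free_res \<one> A = \<one>"
    unfolding u(2) free_act_class[OF one_closed u(1)] free_res_class[OF one_closed u(1)]
    using word_one[OF u(1)] by simp_all
next
  fix g assume g: "g \<in> carrier G"
  have n: "[] \<in> gwords X" by simp
  show "free_act g \<one>\<^bsub>free_grp X\<^esub> = \<one>\<^bsub>free_grp X\<^esub>" "free_res g \<one>\<^bsub>free_grp X\<^esub> = g"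
    unfolding free_class_one free_act_class[OF g n] free_res_class[OF g n] by simp_all
qed

end

section \<open>The extension for a symmetric Rees monoid\<close>

context left_rees_transversal
begin

abbreviation pos :: "'a list \<Rightarrow> 'a gword" where
  "pos xs \<equiv> map (\<lambda>x. (x, True)) xs"

lemma pos_gwords: "xs \<in> lists X \<Longrightarrow> pos xs \<in> gwords X"
  by auto

lemma star_to_free_word_prod:
  assumes "xs \<in> lists X"
  shows "star_to_free M X (word_prod xs) = pres_rel X {} `` {pos xs}"
  unfolding star_to_free_def
proof (rule the_equality)
  show "\<exists>ys\<in>lists X. word_prod xs = word_prod ys \<and> pres_rel X {} `` {pos xs} = pres_rel X {} `` {pos ys}"
    using assms by (intro bexI[of _ xs]) simp_all
  fix c assume "\<exists>ys\<in>lists X. word_prod xs = word_prod ys \<and> c = pres_rel X {} `` {pos ys}"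
  then obtain ys where ys: "ys \<in> lists X" "word_prod xs = word_prod ys" "c = pres_rel X {} `` {pos ys}"
    by (elim bexE conjE)
  then have "xs = ys" using factorization_unique[of xs ys \<one> \<one>] assms by simp
  then show "c = pres_rel X {} `` {pos xs}" using ys by simp
qed

lemma generator_dot_restr_eqI:
  assumes "g \<in> Units M" "x \<in> X" "y \<in> X" "h \<in> Units M" "g \<otimes> x = y \<otimes> h"
  shows "dot M X g x = y" "restr M X g x = h"
proof -
  have "g \<otimes> x = word_prod [y] \<otimes> h" using assms by simp
  from dot_eqI[OF this] restr_eqI[OF this] assms
  show "dot M X g x = y" "restr M X g x = h" by simp_all
qed

text \<open>The two multiplicative laws compare the factorization of \<open>(g h) x\<close> with the one that is found by
  moving first \<open>h\<close> and then \<open>g\<close> past the generator.\<close>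

lemma symmetric_letter_action_units:
  assumes "symmetric_monoid M X"
  shows "symmetric_letter_action (units_of M) X (dot M X) (restr M X)"
proof (intro symmetric_letter_action.intro symmetric_letter_action_axioms.intro units_group,
    unfold units_of_carrier units_of_mult units_of_one)
  show "dot M X g x \<in> X" if "g \<in> Units M" "x \<in> X" for g x
    using that by (rule unit_mult_generator(1))
  show "dot M X \<one> x = x" "restr M X \<one> x = \<one>" if "x \<in> X" for x
    using generator_dot_restr_eqI[of \<one> x x \<one>] that by simp_all
  show "bij_betw (\<lambda>g. restr M X g x) (Units M) (Units M)" if "x \<in> X" for x
    using assms that by (simp add: symmetric_monoid_def)
  fix g h x assume g: "g \<in> Units M" and h: "h \<in> Units M" and x: "x \<in> X"
  note hx = unit_mult_generator[OF h x]
  note ghx = unit_mult_generator[OF g hx(1)]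
  have "(g \<otimes> h) \<otimes> x = g \<otimes> dot M X h x \<otimes> restr M X h x"
    using g h x hx by (simp add: m_assoc)
  also have "\<dots> = dot M X g (dot M X h x) \<otimes> (restr M X g (dot M X h x) \<otimes> restr M X h x)"
    using g h x hx(1,2) ghx by (simp add: m_assoc)
  finally have "(g \<otimes> h) \<otimes> x = dot M X g (dot M X h x) \<otimes> (restr M X g (dot M X h x) \<otimes> restr M X h x)" .
  from generator_dot_restr_eqI[OF _ x ghx(1) _ this] g h hx(2) ghx(2)
  show "dot M X (g \<otimes> h) x = dot M X g (dot M X h x)"
    "restr M X (g \<otimes> h) x = restr M X g (dot M X h x) \<otimes> restr M X h x" by simp_all
qed

text \<open>On positive words the transducer performs the multiplication of \<open>M\<close>: moving \<open>g\<close> past the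
  generators one at a time computes both factors of \<open>g x\<close>.\<close>

lemma extends_star_maps_exists:
  assumes "symmetric_monoid M X"
  shows "\<exists>act res. extends_star_maps M X act res"
proof -
  interpret L: symmetric_letter_action "units_of M" X "dot M X" "restr M X"
    using assms by (rule symmetric_letter_action_units)
  have word: "\<exists>ys\<in>lists X. L.word_act g (pos xs) = pos ys \<and>
      L.word_res g (pos xs) \<in> Units M \<and> g \<otimes> word_prod xs = word_prod ys \<otimes> L.word_res g (pos xs)"
    if "g \<in> Units M" "xs \<in> lists X" for g xs
    using that(2,1)
  proof (induction xs arbitrary: g rule: lists.induct)
    case Nil
    then show ?case by (intro bexI[of _ "[]"]) simp_all
  next
    case (Cons x xs)
    note gx = unit_mult_generator[OF Cons.prems Cons.hyps(1)]
    obtain ys where ys: "ys \<in> lists X" "L.word_act (restr M X g x) (pos xs) = pos ys"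
      "L.word_res (restr M X g x) (pos xs) \<in> Units M"
      "restr M X g x \<otimes> word_prod xs = word_prod ys \<otimes> L.word_res (restr M X g x) (pos xs)"
      using Cons.IH[OF gx(2)] by (elim bexE conjE)
    have "g \<otimes> word_prod (x # xs) = dot M X g x \<otimes> (restr M X g x \<otimes> word_prod xs)"
      using Cons.prems Cons.hyps gx by (simp flip: m_assoc)
    also have "\<dots> = word_prod (dot M X g x # ys) \<otimes> L.word_res (restr M X g x) (pos xs)"
      unfolding ys(4) using gx(1) ys(1,3) by (simp add: m_assoc)
    finally show ?case
      using ys gx(1) by (intro bexI[of _ "dot M X g x # ys"]) simp_all
  qed
  have "L.free_act g (star_to_free M X a) = star_to_free M X (dot M X g a) \<and>
      L.free_res g (star_to_free M X a) = restr M X g a"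
    if g: "g \<in> Units M" and a: "a \<in> star M X" for g a
  proof -
    from a obtain xs where xs: "xs \<in> lists X" "a = word_prod xs" unfolding star_eq by (elim imageE)
    obtain ys where ys: "ys \<in> lists X" "L.word_act g (pos xs) = pos ys"
      "L.word_res g (pos xs) \<in> Units M"
      "g \<otimes> word_prod xs = word_prod ys \<otimes> L.word_res g (pos xs)"
      using word[OF g xs(1)] by (elim bexE conjE)
    have g': "g \<in> carrier (units_of M)" using g by (simp add: units_of_carrier)
    show ?thesis
      unfolding xs(2) dot_eqI[OF ys(4,1,3)] restr_eqI[OF ys(4,1,3)]
        star_to_free_word_prod[OF xs(1)] star_to_free_word_prod[OF ys(1)]
        L.free_act_class[OF g' pos_gwords[OF xs(1)]] L.free_res_class[OF g' pos_gwords[OF xs(1)]] ys(2)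
      by simp
  qed
  then have "extends_star_maps M X L.free_act L.free_res"
    unfolding extends_star_maps_def using L.zappa_szep_free_grp by simp
  then show ?thesis by (intro exI)
qed

end

section \<open>The group of fractions\<close>

text \<open>In a Zappa-Szep product \<open>(x, g) = (x, 1) (1, g)\<close>, so a homomorphism out of it is determined
  by its restrictions \<open>\<alpha>\<close>, \<open>\<beta>\<close> to the factors; what they have to satisfy is the exchange law \<open>g x = (g \<cdot> x) (g|\<^sub>x)\<close>.\<close>

lemma (in zappa_szep) product_hom:
  assumes "group H" "\<alpha> \<in> hom F H" "\<beta> \<in> hom G H"
    and exchange: "\<And>g x. \<lbrakk>g \<in> carrier G; x \<in> carrier F\<rbrakk> \<Longrightarrow>
      \<beta> g \<otimes>\<^bsub>H\<^esub> \<alpha> x = \<alpha> (act g x) \<otimes>\<^bsub>H\<^esub> \<beta> (res g x)"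
  shows "(\<lambda>(x, g). \<alpha> x \<otimes>\<^bsub>H\<^esub> \<beta> g) \<in> hom (zappa_szep_product F G act res) H"
proof (rule homI)
  interpret H: group H by fact
  have c: "\<alpha> x \<in> carrier H" "\<beta> g \<in> carrier H" if "x \<in> carrier F" "g \<in> carrier G" for x g
    using assms(2,3) that by (simp_all add: hom_in_carrier)
  fix p assume "p \<in> carrier (zappa_szep_product F G act res)"
  then obtain x g where p: "p = (x, g)" "x \<in> carrier F" "g \<in> carrier G"
    by (auto simp: zappa_szep_product_def)
  then show "(case p of (x, g) \<Rightarrow> \<alpha> x \<otimes>\<^bsub>H\<^esub> \<beta> g) \<in> carrier H" using c by simp
  fix q assume "q \<in> carrier (zappa_szep_product F G act res)"
  then obtain y h where q: "q = (y, h)" "y \<in> carrier F" "h \<in> carrier G"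
    by (auto simp: zappa_szep_product_def)
  have a: "act g y \<in> carrier F" "res g y \<in> carrier G" using p q act_closed res_closed by simp_all
  have "\<alpha> (x \<otimes>\<^bsub>F\<^esub> act g y) \<otimes>\<^bsub>H\<^esub> \<beta> (res g y \<otimes>\<^bsub>G\<^esub> h)
      = \<alpha> x \<otimes>\<^bsub>H\<^esub> (\<alpha> (act g y) \<otimes>\<^bsub>H\<^esub> \<beta> (res g y)) \<otimes>\<^bsub>H\<^esub> \<beta> h"
    using p q a c by (simp add: hom_mult[OF assms(2)] hom_mult[OF assms(3)] H.m_assoc)
  also have "\<dots> = \<alpha> x \<otimes>\<^bsub>H\<^esub> \<beta> g \<otimes>\<^bsub>H\<^esub> (\<alpha> y \<otimes>\<^bsub>H\<^esub> \<beta> h)"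
    unfolding exchange[OF p(3) q(2), symmetric] using p q c by (simp add: H.m_assoc)
  finally show "(case p \<otimes>\<^bsub>zappa_szep_product F G act res\<^esub> q of (x, g) \<Rightarrow> \<alpha> x \<otimes>\<^bsub>H\<^esub> \<beta> g) =
      (case p of (x, g) \<Rightarrow> \<alpha> x \<otimes>\<^bsub>H\<^esub> \<beta> g) \<otimes>\<^bsub>H\<^esub> (case q of (x, g) \<Rightarrow> \<alpha> x \<otimes>\<^bsub>H\<^esub> \<beta> g)"
    using p q by (simp add: zappa_szep_product_def)
qed

text \<open>The elements \<open>x\<close> for which the exchange law holds against all \<open>g\<close> form a subgroup: for an inverse,
  apply the law of \<open>x\<close> to \<open>k = g|\<^bsub>x\<^sup>-\<^sup>1\<^esub>\<close>, using \<open>g \<cdot> x\<^sup>-\<^sup>1 = (k \<cdot> x)\<^sup>-\<^sup>1\<close> and \<open>k|\<^sub>x = g\<close>.\<close>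

lemma (in zappa_szep) exchange_subgroup:
  assumes "group H" "\<alpha> \<in> hom F H" "\<beta> \<in> hom G H"
  shows "subgroup {x \<in> carrier F. \<forall>g\<in>carrier G. \<beta> g \<otimes>\<^bsub>H\<^esub> \<alpha> x = \<alpha> (act g x) \<otimes>\<^bsub>H\<^esub> \<beta> (res g x)} F"
    (is "subgroup ?S F")
proof (rule F.subgroupI)
  interpret H: group H by fact
  interpret \<alpha>: group_hom F H \<alpha>
    using assms F.group_axioms by (simp add: group_hom_def group_hom_axioms_def)
  show "?S \<subseteq> carrier F" by simp
  have "\<one>\<^bsub>F\<^esub> \<in> ?S"
    using assms(3) by (simp add: act_one res_one hom_in_carrier[OF assms(3)])
  then show "?S \<noteq> {}" by auto
next
  interpret H: group H by fact
  interpret \<alpha>: group_hom F H \<alpha>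
    using assms F.group_axioms by (simp add: group_hom_def group_hom_axioms_def)
  note \<beta>c = hom_in_carrier[OF assms(3)]
  fix x assume x: "x \<in> ?S"
  then have xF: "x \<in> carrier F" by simp
  show "inv\<^bsub>F\<^esub> x \<in> ?S"
  proof (clarsimp, intro conjI ballI)
    show "inv\<^bsub>F\<^esub> x \<in> carrier F" using x by simp
    fix g assume g: "g \<in> carrier G"
    define k where "k = res g (inv\<^bsub>F\<^esub> x)"
    define y where "y = act g (inv\<^bsub>F\<^esub> x)"
    have k: "k \<in> carrier G" and y: "y \<in> carrier F" and kx: "act k x \<in> carrier F"
      using x g by (simp_all add: k_def y_def res_closed act_closed)
    have "res k x = g" unfolding k_def using x g by (simp add: res_mult[symmetric] res_one)
    moreover have "y \<otimes>\<^bsub>F\<^esub> act k x = \<one>\<^bsub>F\<^esub>"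
      unfolding y_def k_def using x g by (simp add: act_mult[symmetric] act_one)
    then have "inv\<^bsub>F\<^esub> (act k x) = y" by (rule F.inv_equality) (use y kx in auto)
    moreover have "\<beta> k \<otimes>\<^bsub>H\<^esub> \<alpha> x = \<alpha> (act k x) \<otimes>\<^bsub>H\<^esub> \<beta> (res k x)" using x k by simp
    ultimately have e: "\<beta> k \<otimes>\<^bsub>H\<^esub> \<alpha> x = \<alpha> (act k x) \<otimes>\<^bsub>H\<^esub> \<beta> g" and y': "\<alpha> y = inv\<^bsub>H\<^esub> \<alpha> (act k x)"
      using kx by auto
    have "\<beta> g \<otimes>\<^bsub>H\<^esub> inv\<^bsub>H\<^esub> \<alpha> x = \<alpha> y \<otimes>\<^bsub>H\<^esub> (\<alpha> (act k x) \<otimes>\<^bsub>H\<^esub> \<beta> g) \<otimes>\<^bsub>H\<^esub> inv\<^bsub>H\<^esub> \<alpha> x"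
      unfolding y' using g x kx \<beta>c by (simp flip: H.m_assoc)
    also have "\<dots> = \<alpha> y \<otimes>\<^bsub>H\<^esub> \<beta> k"
      unfolding e[symmetric] using k xF y \<beta>c by (simp add: H.m_assoc)
    finally show "\<beta> g \<otimes>\<^bsub>H\<^esub> \<alpha> (inv\<^bsub>F\<^esub> x) = \<alpha> (act g (inv\<^bsub>F\<^esub> x)) \<otimes>\<^bsub>H\<^esub> \<beta> (res g (inv\<^bsub>F\<^esub> x))"
      unfolding k_def y_def using x by simp
  qed
  fix y assume y: "y \<in> ?S"
  then have yF: "y \<in> carrier F" by simp
  show "x \<otimes>\<^bsub>F\<^esub> y \<in> ?S"
  proof (clarsimp, intro conjI ballI)
    show "x \<otimes>\<^bsub>F\<^esub> y \<in> carrier F" using x y by simp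
    fix g assume g: "g \<in> carrier G"
    have k: "res g x \<in> carrier G" and z: "act g x \<in> carrier F" "act (res g x) y \<in> carrier F"
      "res (res g x) y \<in> carrier G"
      using x y g by (simp_all add: res_closed act_closed)
    have ex: "\<beta> g \<otimes>\<^bsub>H\<^esub> \<alpha> x = \<alpha> (act g x) \<otimes>\<^bsub>H\<^esub> \<beta> (res g x)" using x g by simp
    have ey: "\<beta> (res g x) \<otimes>\<^bsub>H\<^esub> \<alpha> y = \<alpha> (act (res g x) y) \<otimes>\<^bsub>H\<^esub> \<beta> (res (res g x) y)" using y k by simp
    have "\<beta> g \<otimes>\<^bsub>H\<^esub> \<alpha> (x \<otimes>\<^bsub>F\<^esub> y) = \<beta> g \<otimes>\<^bsub>H\<^esub> \<alpha> x \<otimes>\<^bsub>H\<^esub> \<alpha> y"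
      using xF yF g \<beta>c by (simp add: H.m_assoc)
    also have "\<dots> = \<alpha> (act g x) \<otimes>\<^bsub>H\<^esub> (\<beta> (res g x) \<otimes>\<^bsub>H\<^esub> \<alpha> y)"
      unfolding ex using yF z k \<beta>c by (simp add: H.m_assoc)
    also have "\<dots> = \<alpha> (act g (x \<otimes>\<^bsub>F\<^esub> y)) \<otimes>\<^bsub>H\<^esub> \<beta> (res g (x \<otimes>\<^bsub>F\<^esub> y))"
      unfolding ey using xF yF g z \<beta>c by (simp add: act_mult res_mult H.m_assoc)
    finally show "\<beta> g \<otimes>\<^bsub>H\<^esub> \<alpha> (x \<otimes>\<^bsub>F\<^esub> y) = \<alpha> (act g (x \<otimes>\<^bsub>F\<^esub> y)) \<otimes>\<^bsub>H\<^esub> \<beta> (res g (x \<otimes>\<^bsub>F\<^esub> y))" .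
  qed
qed

lemma presented_group_generated:
  assumes S: "subgroup S (presented_group X R)"
    and gens: "\<And>x. x \<in> X \<Longrightarrow> pres_rel X R `` {[(x, True)]} \<in> S"
    and A: "A \<in> carrier (presented_group X R)"
  shows "A \<in> S"
proof -
  let ?P = "presented_group X R"
  let ?c = "\<lambda>w. pres_rel X R `` {w}"
  interpret P: group ?P by (rule group_presented_group)
  interpret S: subgroup S ?P by (rule S)
  have letter: "?c [(x, b)] \<in> S" if x: "x \<in> X" for x b
  proof (cases b)
    case True
    then show ?thesis using gens[OF x] by simp
  next
    case False
    have t: "[(x, True)] \<in> gwords X" and n: "[(x, False)] \<in> gwords X" using x by auto
    have "([(x, False), (x, True)], []) \<in> pres_rel X R"
      using pres_rel.cancel[of "[]" X "[]" x False R] x by simp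
    then have "?c [(x, False)] \<otimes>\<^bsub>?P\<^esub> ?c [(x, True)] = \<one>\<^bsub>?P\<^esub>"
      unfolding presented_group_mult[OF n t] presented_group_one
      by (simp add: equiv_class_eq[OF equiv_pres_rel])
    then have "inv\<^bsub>?P\<^esub> (?c [(x, True)]) = ?c [(x, False)]"
      by (rule P.inv_equality[OF _ presented_group_class[OF t] presented_group_class[OF n]])
    then show ?thesis using False S.m_inv_closed[OF gens[OF x]] by simp
  qed
  have "?c w \<in> S" if "w \<in> gwords X" for w
    using that
  proof (induction w rule: list.induct)
    case Nil
    show ?case using S.one_closed by (simp only: presented_group_one)
  next
    case (Cons l w)
    obtain x b where l: "l = (x, b)" by (cases l)
    have lw: "[l] \<in> gwords X" "w \<in> gwords X" "x \<in> X" using Cons.prems l by simp_all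
    have "?c (l # w) = ?c [l] \<otimes>\<^bsub>?P\<^esub> ?c w" unfolding presented_group_mult[OF lw(1,2)] by simp
    then show ?case using S.m_closed[OF letter[OF lw(3), of b] Cons.IH[OF lw(2)]] l by simp
  qed
  then show ?thesis using A by (metis presented_group_cases)
qed

context left_rees_transversal
begin

definition factor_pair :: "'a \<Rightarrow> 'a gword set \<times> 'a" where
  "factor_pair a = (THE p. \<exists>xs\<in>lists X. \<exists>g\<in>Units M.
     a = word_prod xs \<otimes> g \<and> p = (pres_rel X {} `` {pos xs}, g))"

lemma factor_pair_eq:
  assumes "xs \<in> lists X" "g \<in> Units M"
  shows "factor_pair (word_prod xs \<otimes> g) = (pres_rel X {} `` {pos xs}, g)"
  unfolding factor_pair_def
proof (rule the_equality)
  show "\<exists>ys\<in>lists X. \<exists>h\<in>Units M. word_prod xs \<otimes> g = word_prod ys \<otimes> h \<and>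
      (pres_rel X {} `` {pos xs}, g) = (pres_rel X {} `` {pos ys}, h)"
    using assms by (intro bexI[of _ xs] bexI[of _ g]) simp_all
  fix p assume "\<exists>ys\<in>lists X. \<exists>h\<in>Units M. word_prod xs \<otimes> g = word_prod ys \<otimes> h \<and>
      p = (pres_rel X {} `` {pos ys}, h)"
  then obtain ys h where ys: "ys \<in> lists X" "h \<in> Units M" "word_prod xs \<otimes> g = word_prod ys \<otimes> h"
    "p = (pres_rel X {} `` {pos ys}, h)" by (elim bexE conjE)
  then show "p = (pres_rel X {} `` {pos xs}, g)"
    using factorization_unique[OF assms(1) ys(1) assms(2) ys(2,3)] by simp
qed

lemma free_pos_closed: "xs \<in> lists X \<Longrightarrow> pres_rel X {} `` {pos xs} \<in> carrier (free_grp X)"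
  unfolding free_grp_def by (rule presented_group_class[OF pos_gwords])

lemma free_pos_mult:
  assumes "xs \<in> lists X" "ys \<in> lists X"
  shows "pres_rel X {} `` {pos xs} \<otimes>\<^bsub>free_grp X\<^esub> pres_rel X {} `` {pos ys} = pres_rel X {} `` {pos (xs @ ys)}"
  unfolding free_grp_def presented_group_mult[OF assms[THEN pos_gwords]] by simp

text \<open>The factorization of \<open>(x g) (y h)\<close> is \<open>x (g \<cdot> y)\<close> followed by \<open>g|\<^sub>y h\<close>; the multiplication of the
  Zappa-Szep product is the same formula.\<close>

lemma factor_pair_hom:
  assumes "extends_star_maps M X act res"
  shows "factor_pair \<in> hom M (zappa_szep_product (free_grp X) (units_of M) act res)"
proof (rule homI)
  fix a assume a: "a \<in> carrier M"
  obtain xs g where xs: "xs \<in> lists X" "g \<in> Units M" "a = word_prod xs \<otimes> g"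
    using factorization_exists[OF a] by (elim bexE)
  show "factor_pair a \<in> carrier (zappa_szep_product (free_grp X) (units_of M) act res)"
    unfolding xs(3) factor_pair_eq[OF xs(1,2)]
    using free_pos_closed xs by (simp add: zappa_szep_product_def units_of_carrier)
  fix b assume b: "b \<in> carrier M"
  obtain ys h where ys: "ys \<in> lists X" "h \<in> Units M" "b = word_prod ys \<otimes> h"
    using factorization_exists[OF b] by (elim bexE)
  define k where "k = restr M X g (word_prod ys)"
  obtain zs where zs: "zs \<in> lists X" "dot M X g (word_prod ys) = word_prod zs" "k \<in> Units M"
    "g \<otimes> word_prod ys = word_prod zs \<otimes> k"
    using unit_mult_star[OF xs(2) ys(1)] unfolding k_def .
  have "word_prod ys \<in> star M X" unfolding star_eq using ys(1) by (rule imageI)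
  then have act: "act g (pres_rel X {} `` {pos ys}) = pres_rel X {} `` {pos zs}"
    and res: "res g (pres_rel X {} `` {pos ys}) = k"
    using assms xs(2) unfolding extends_star_maps_def k_def
    by (metis star_to_free_word_prod ys(1) zs(1,2))+
  have "a \<otimes> b = word_prod xs \<otimes> (g \<otimes> word_prod ys) \<otimes> h"
    using xs ys by (simp add: m_assoc)
  also have "\<dots> = word_prod (xs @ zs) \<otimes> (k \<otimes> h)"
    unfolding zs(4) word_prod_append[OF xs(1) zs(1)] using xs ys zs by (simp add: m_assoc)
  finally have ab: "a \<otimes> b = word_prod (xs @ zs) \<otimes> (k \<otimes> h)" .
  have "xs @ zs \<in> lists X" "k \<otimes> h \<in> Units M" using xs ys zs by simp_all
  note ab_pair = factor_pair_eq[OF this]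
  show "factor_pair (a \<otimes> b)
      = factor_pair a \<otimes>\<^bsub>zappa_szep_product (free_grp X) (units_of M) act res\<^esub> factor_pair b"
    unfolding ab ab_pair
    unfolding xs(3) factor_pair_eq[OF xs(1,2)] ys(3) factor_pair_eq[OF ys(1,2)]
    by (simp only: zappa_szep_product_def monoid.simps prod.case act res free_pos_mult[OF xs(1) zs(1)]
        units_of_mult)
qed

lemma fractions_group_iso_zappa_szep:
  assumes ext: "extends_star_maps M X act res"
  shows "fractions_group M \<cong> zappa_szep_product (free_grp X) (units_of M) act res"
proof -
  let ?U = "fractions_group M" and ?fm = "fractions_map M"
  let ?Z = "zappa_szep_product (free_grp X) (units_of M) act res"
  let ?gen = "\<lambda>x. pres_rel X {} `` {[(x, True)]}"
  interpret Z: zappa_szep "free_grp X" "units_of M" act res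
    using ext unfolding extends_star_maps_def by simp
  interpret U: group ?U by (rule group_fractions_group)
  have grpZ: "group ?Z" by (rule Z.group_zappa_szep_product)
  note fm = fractions_map_hom[OF monoid_axioms]
  note fm_c = hom_in_carrier[OF fm]
  have fm_one: "?fm \<one> = \<one>\<^bsub>?U\<^esub>"
    using hom_mult[OF fm one_closed one_closed] fm_c[OF one_closed] U.r_cancel_one by simp

  obtain \<phi> where \<phi>: "\<phi> \<in> hom ?U ?Z" and \<phi>_fm: "\<And>a. a \<in> carrier M \<Longrightarrow> \<phi> (?fm a) = factor_pair a"
    using fractions_group_universal[OF monoid_axioms grpZ factor_pair_hom[OF ext]] by auto

  have "?fm \<in> X \<rightarrow> carrier ?U" using fm_c by auto
  from free_grp_universal[OF group_fractions_group this]
  obtain \<alpha> where \<alpha>: "\<alpha> \<in> hom (free_grp X) ?U" and \<alpha>_gen: "\<And>x. x \<in> X \<Longrightarrow> \<alpha> (?gen x) = ?fm x"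
    by auto
  note \<alpha>_c = hom_in_carrier[OF \<alpha>]
  have \<beta>: "?fm \<in> hom (units_of M) ?U"
    using fm_c hom_mult[OF fm] by (intro homI) (simp_all add: units_of_carrier units_of_mult)
  have \<alpha>_pos: "\<alpha> (pres_rel X {} `` {pos xs}) = ?fm (word_prod xs)" if "xs \<in> lists X" for xs
    using that
  proof (induction xs rule: lists.induct)
    case Nil
    have "\<alpha> \<one>\<^bsub>free_grp X\<^esub> = \<one>\<^bsub>?U\<^esub>" by (rule hom_one[OF \<alpha> group_free_grp group_fractions_group])
    then show ?case by (simp add: fm_one free_grp_def presented_group_one)
  next
    case (Cons x xs)
    then have x: "[x] \<in> lists X" by simp
    have "\<alpha> (pres_rel X {} `` {pos (x # xs)}) = \<alpha> (?gen x) \<otimes>\<^bsub>?U\<^esub> \<alpha> (pres_rel X {} `` {pos xs})"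
      using hom_mult[OF \<alpha> free_pos_closed[OF x] free_pos_closed[OF Cons.hyps(2)]]
        free_pos_mult[OF x Cons.hyps(2)] by simp
    also have "\<dots> = ?fm (word_prod (x # xs))"
      unfolding \<alpha>_gen[OF Cons.hyps(1)] Cons.IH using Cons.hyps hom_mult[OF fm] by simp
    finally show ?case .
  qed

  have exchange: "?fm g \<otimes>\<^bsub>?U\<^esub> \<alpha> A = \<alpha> (act g A) \<otimes>\<^bsub>?U\<^esub> ?fm (res g A)"
    if g: "g \<in> carrier (units_of M)" and A: "A \<in> carrier (free_grp X)" for g A
  proof -
    let ?S = "{A \<in> carrier (free_grp X). \<forall>g\<in>carrier (units_of M).
      ?fm g \<otimes>\<^bsub>?U\<^esub> \<alpha> A = \<alpha> (act g A) \<otimes>\<^bsub>?U\<^esub> ?fm (res g A)}"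
    have "?gen x \<in> ?S" if x: "x \<in> X" for x
    proof (intro CollectI conjI ballI)
      have xl: "[x] \<in> lists X" using x by simp
      show "?gen x \<in> carrier (free_grp X)" using free_pos_closed[OF xl] by simp
      fix g assume "g \<in> carrier (units_of M)"
      then have g: "g \<in> Units M" by (simp add: units_of_carrier)
      note gx = unit_mult_generator[OF g x]
      have gxl: "[dot M X g x] \<in> lists X" using gx by simp
      have xs: "x \<in> star M X" "star_to_free M X x = ?gen x"
        unfolding star_eq using image_eqI[of x word_prod "[x]"] xl star_to_free_word_prod[OF xl] x
        by simp_all
      have "star_to_free M X (dot M X g x) = ?gen (dot M X g x)"
        using star_to_free_word_prod[OF gxl] gx by simp
      then have "act g (?gen x) = ?gen (dot M X g x)" "res g (?gen x) = restr M X g x"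
        using ext g xs unfolding extends_star_maps_def by metis+
      then show "?fm g \<otimes>\<^bsub>?U\<^esub> \<alpha> (?gen x) = \<alpha> (act g (?gen x)) \<otimes>\<^bsub>?U\<^esub> ?fm (res g (?gen x))"
        using gx x g \<alpha>_gen hom_mult[OF fm, of g x] hom_mult[OF fm, of "dot M X g x" "restr M X g x"]
        by simp
    qed
    then have "A \<in> ?S"
      using presented_group_generated[OF Z.exchange_subgroup[OF group_fractions_group \<alpha> \<beta>,
          unfolded free_grp_def]] A
      unfolding free_grp_def by blast
    then show ?thesis using g by simp
  qed
  define \<psi> where "\<psi> = (\<lambda>(A, g). \<alpha> A \<otimes>\<^bsub>?U\<^esub> ?fm g)"
  have \<psi>: "\<psi> \<in> hom ?Z ?U"
    unfolding \<psi>_def by (rule Z.product_hom[OF group_fractions_group \<alpha> \<beta> exchange])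

  have \<psi>\<phi>: "\<psi> (\<phi> A) = A" if A: "A \<in> carrier ?U" for A
  proof -
    have "(\<psi> \<circ> \<phi>) A = id A"
    proof (rule presented_group_hom_unique[OF group_fractions_group, where \<phi> = "\<psi> \<circ> \<phi>" and \<psi> = id
          and X = "carrier M" and R = "mult_rel M"])
      show "\<psi> \<circ> \<phi> \<in> hom (presented_group (carrier M) (mult_rel M)) ?U"
        using hom_compose[OF \<phi> \<psi>] by (simp only: fractions_group_def)
      show "id \<in> hom (presented_group (carrier M) (mult_rel M)) ?U"
        unfolding fractions_group_def by (rule homI) simp_all
      show "A \<in> carrier (presented_group (carrier M) (mult_rel M))"
        using A by (simp only: fractions_group_def)
      fix a assume a: "a \<in> carrier M"
      obtain xs g where xs: "xs \<in> lists X" "g \<in> Units M" "a = word_prod xs \<otimes> g"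
        using factorization_exists[OF a] by (elim bexE)
      have "\<psi> (\<phi> (?fm a)) = \<alpha> (pres_rel X {} `` {pos xs}) \<otimes>\<^bsub>?U\<^esub> ?fm g"
        using \<phi>_fm[OF a] factor_pair_eq[OF xs(1,2)] by (simp add: xs(3) \<psi>_def)
      also have "\<dots> = ?fm a"
        unfolding \<alpha>_pos[OF xs(1)] using hom_mult[OF fm, of "word_prod xs" g] xs by simp
      finally show "(\<psi> \<circ> \<phi>) (pres_rel (carrier M) (mult_rel M) `` {[(a, True)]}) =
          id (pres_rel (carrier M) (mult_rel M) `` {[(a, True)]})"
        unfolding fractions_map_def by simp
    qed
    then show ?thesis by simp
  qed

  have \<phi>\<alpha>: "\<phi> (\<alpha> A) = (A, \<one>)" if A: "A \<in> carrier (free_grp X)" for A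
  proof -
    have "(\<phi> \<circ> \<alpha>) A = (\<lambda>A. (A, \<one>)) A"
    proof (rule presented_group_hom_unique[OF grpZ, where \<phi> = "\<phi> \<circ> \<alpha>" and \<psi> = "\<lambda>A. (A, \<one>)"
          and X = X and R = "{}"])
      show "\<phi> \<circ> \<alpha> \<in> hom (presented_group X {}) ?Z"
        using hom_compose[OF \<alpha> \<phi>] by (simp only: free_grp_def)
      show "A \<in> carrier (presented_group X {})" using A by (simp only: free_grp_def)
      have "(\<lambda>A. (A, \<one>\<^bsub>units_of M\<^esub>)) \<in> hom (free_grp X) ?Z"
        by (rule homI) (simp_all add: zappa_szep_product_def Z.one_act Z.one_res)
      then show "(\<lambda>A. (A, \<one>)) \<in> hom (presented_group X {}) ?Z"
        by (simp only: free_grp_def units_of_one)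
      fix x assume x: "x \<in> X"
      have "factor_pair x = (?gen x, \<one>)" using factor_pair_eq[of "[x]" \<one>] x by simp
      then show "(\<phi> \<circ> \<alpha>) (?gen x) = (?gen x, \<one>)" using \<alpha>_gen \<phi>_fm x by simp
    qed
    then show ?thesis by simp
  qed
  have \<phi>\<psi>: "\<phi> (\<psi> p) = p" if p: "p \<in> carrier ?Z" for p
  proof -
    obtain A g where Ag: "p = (A, g)" "A \<in> carrier (free_grp X)" "g \<in> Units M"
      using p by (auto simp: zappa_szep_product_def units_of_carrier)
    have "factor_pair g = (\<one>\<^bsub>free_grp X\<^esub>, g)"
      using factor_pair_eq[of "[]" g] Ag by (simp add: free_grp_def presented_group_one)
    then have "\<phi> (\<psi> p) = (A, \<one>) \<otimes>\<^bsub>?Z\<^esub> (\<one>\<^bsub>free_grp X\<^esub>, g)"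
      using hom_mult[OF \<phi> \<alpha>_c[OF Ag(2)] fm_c] \<phi>\<alpha> \<phi>_fm Ag by (simp add: \<psi>_def)
    also have "\<dots> = p"
      using Ag Z.act_one Z.res_one Z.G.one_closed
      by (simp add: zappa_szep_product_def units_of_carrier units_of_mult units_of_one)
    finally show ?thesis .
  qed
  have "bij_betw \<phi> (carrier ?U) (carrier ?Z)"
    by (rule bij_betw_byWitness[where f' = \<psi>])
      (use \<psi>\<phi> \<phi>\<psi> hom_in_carrier[OF \<phi>] hom_in_carrier[OF \<psi>] in auto)
  then show ?thesis using \<phi> unfolding is_iso_def iso_def by auto
qed

end

theorem theorem2p4p2:
  fixes M :: "('a, 'b) monoid_scheme" and X :: "'a set"
  assumes "rees_monoid M"
    and "is_transversal M X"
    and "symmetric_monoid M X"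
  shows "(\<exists>act res. extends_star_maps M X act res) \<and>
         (\<forall>act res. extends_star_maps M X act res \<longrightarrow>
            fractions_group M \<cong> zappa_szep_product (free_grp X) (units_of M) act res)"
proof -
  have left: "left_rees_monoid M" using assms(1) by (simp add: rees_monoid_def)
  then have "monoid M" by (simp add: left_rees_monoid_def)
  then interpret left_rees_transversal M X
    by (intro left_rees_transversal.intro left_rees_transversal_axioms.intro left assms(2))
  show ?thesis
    using extends_star_maps_exists[OF assms(3)] fractions_group_iso_zappa_szep by simp
qed

end
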